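(* The quaternary quadratic form $Q_{31}^2=x^2+2y^2+4z^2+5w^2+2yw+2yz$ (Gram matrix $\begin{pmatrix}1&0&0&0\\0&2&1&1\\0&1&4&0\\0&1&0&5\end{pmatrix}$) is primitively universal.
   Context: A quadratic form $f$ in variables $x,y,z,w$ is primitively universal if for every positive integer $n$ the equation $f(x,y,z,w)=n$ has an integer solution with $\gcd(x,y,z,w)=1$. *)

theory Defs
  imports "HOL-Analysis.Analysis"
begin

definition primitively_universal :: "(int \<Rightarrow> int \<Rightarrow> int \<Rightarrow> int \<Rightarrow> int) \<Rightarrow> bool" where
  "primitively_universal f \<longleftrightarrow>
    (\<forall>n>0. \<exists>x y z w. f x y z w = n \<and> Gcd {x, y, z, w} = 1)"

text \<open>The name \<open>Q31_2\<close> stands for $Q_{31}^2$; the superscript is an index, not a square.\<close>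

definition Q31_2 :: "int \<Rightarrow> int \<Rightarrow> int \<Rightarrow> int \<Rightarrow> int" where
  "Q31_2 x y z w = x\<^sup>2 + 2 * y\<^sup>2 + 4 * z\<^sup>2 + 5 * w\<^sup>2 + 2 * y * w + 2 * y * z"

definition Q31_2_gram :: "int ^ 4 ^ 4" where
  "Q31_2_gram = vector [vector [1, 0, 0, 0],
                        vector [0, 2, 1, 1],
                        vector [0, 1, 4, 0],
                        vector [0, 1, 0, 5]]"

lemma vector_4 [simp]:
  "(vector [a, b, c, d] :: ('a::zero) ^ 4) $ 1 = a"
  "(vector [a, b, c, d] :: ('a::zero) ^ 4) $ 2 = b"
  "(vector [a, b, c, d] :: ('a::zero) ^ 4) $ 3 = c"
  "(vector [a, b, c, d] :: ('a::zero) ^ 4) $ 4 = d"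
  unfolding vector_def by simp_all

lemma Q31_2_eq_gram:
  fixes v :: "int ^ 4"
  shows "Q31_2 (v $ 1) (v $ 2) (v $ 3) (v $ 4) = (\<Sum>i\<in>UNIV. v $ i * (Q31_2_gram *v v) $ i)"
  by (simp add: Q31_2_def Q31_2_gram_def matrix_vector_mult_def sum_4
      power2_eq_square algebra_simps)

end

theory Submission
  imports Defs "HOL-Number_Theory.Number_Theory"
begin

text \<open>
  The vectors with \<open>z = 0\<close> form the ternary lattice \<open>x\<^sup>2 + 2y\<^sup>2 + 5w\<^sup>2 + 2yw\<close>, which is isometric to the
  index 3 sublattice \<open>b + c \<equiv> 0 (mod 3)\<close> of \<open>a\<^sup>2 + b\<^sup>2 + c\<^sup>2\<close>. Two of three given integers agree modulo 3
  up to sign, so every primitive sum of three squares is primitively represented by this ternary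
  lattice; these are the numbers that are not 0, 4 or 7 modulo 8. The orthogonal complement of the
  lattice is spanned by a vector of norm \<open>279 \<equiv> 7 (mod 8)\<close>, and subtracting 279 or \<open>4 \<cdot> 279\<close> moves
  the remaining residue classes to represented ones. This leaves finitely many numbers.

  For the primitive three squares theorem, a ternary form of determinant 1 with first coefficient \<open>m\<close>
  is built from a prime \<open>p\<close> with prescribed Legendre symbols modulo the prime factors of \<open>m\<close>; such
  a form is equivalent to the sum of three squares. Only real characters are needed to find \<open>p\<close>:
  expanding \<open>\<Prod>\<^sub>i (1 + \<epsilon>\<^sub>i \<chi>\<^sub>i(n))\<close> under the series of \<open>\<Lambda>(n) n\<close> to the power \<open>-s\<close> leaves, as \<open>s \<rightarrow> 1\<close>, one
  divergent term and terms that are bounded because \<open>L(1, \<chi>) \<noteq> 0\<close> for real \<open>\<chi>\<close>.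
\<close>

section \<open>Dirichlet series of real characters\<close>

text \<open>Vectors with \<open>z = 0\<close> cannot suffice: a sum of three squares divisible by 4
  has only even terms, so multiples of 4 have no primitive representation there, and numbers that
  are 7 modulo 8 have none at all. Hence one must leave the ternary lattice and still control the
  gcd. The quaternary lattice has determinant 31 and the ternary one 9; since 9 * 279 = 31 * 81, the
  ternary lattice and its orthogonal vector span a sublattice of index 9. This is the coordinate -9
  of that vector, and it makes 3 the only prime at which a translate can lose primitivity.

  The analytic obstacle is L(1, \<psi>) \<noteq> 0. It is settled on the real line, by comparing
  L(1, \<psi>) / (1 - t) with a Lambert series as t tends to 1 from below. Real characters suffice
  because reciprocity turns both divisibility conditions on the ternary form into prescribed signs
  at the prime factors of \<open>m\<close> and a residue of \<open>p\<close> modulo 8, and such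
  conditions single out \<open>p\<close> only up to squares.\<close>

text \<open>Abel summation turns the sum into a combination of the partial sums of \<open>f\<close>,
  with nonnegative coefficients of total \<open>a m\<close>.\<close>

lemma abs_sum_monotone_weights_le:
  fixes f a :: "nat \<Rightarrow> real"
  assumes bound: "\<And>n. \<bar>\<Sum>k=m..<n. f k\<bar> \<le> B"
    and dec: "\<And>k. k \<ge> m \<Longrightarrow> a (Suc k) \<le> a k" and nonneg: "\<And>k. k \<ge> m \<Longrightarrow> a k \<ge> 0"
  shows "\<bar>\<Sum>k=m..<n. f k * a k\<bar> \<le> B * a m"
proof (cases "m \<le> n")
  case True
  define F where "F j = (\<Sum>k=m..<j. f k)" for j
  have eq: "(\<Sum>k=m..<n. f k * a k) = a n * F n + (\<Sum>k=m..<n. (a k - a (Suc k)) * F (Suc k))"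
    using True
  proof (induction n rule: dec_induct)
    case (step n)
    then show ?case by (simp add: F_def algebra_simps)
  qed (simp add: F_def)
  have Fb: "\<bar>F j\<bar> \<le> B" for j
    unfolding F_def by (rule bound)
  have tele: "(\<Sum>k=m..<n. a k - a (Suc k)) = a m - a n"
    using True by (induction n rule: dec_induct) auto
  have "\<bar>\<Sum>k=m..<n. f k * a k\<bar> \<le> \<bar>a n * F n\<bar> + (\<Sum>k=m..<n. \<bar>(a k - a (Suc k)) * F (Suc k)\<bar>)"
    unfolding eq by (intro order.trans[OF abs_triangle_ineq] add_mono sum_abs order.refl)
  also have "\<dots> \<le> a n * B + (\<Sum>k=m..<n. (a k - a (Suc k)) * B)"
    using True Fb dec nonneg
    by (intro add_mono sum_mono) (auto simp: abs_mult intro!: mult_mono)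
  also have "\<dots> = B * a m"
    by (simp only: sum_distrib_right[symmetric] tele) (simp add: algebra_simps)
  finally show ?thesis .
next
  case False
  then show ?thesis using bound[of m] nonneg[of m] by auto
qed

text \<open>The explicit tail bound is what gives uniformity in \<open>s\<close> and
  \<open>t\<close> later. \<open>K\<close> skips the start, where the weights need not decrease: 1/n
  has the value 0 at 0, and ln n / n still grows before 3.\<close>

lemma dirichlet_test:
  fixes f a :: "nat \<Rightarrow> real"
  assumes bound: "\<And>m n. \<bar>\<Sum>k=m..<n. f k\<bar> \<le> B"
    and dec: "\<And>k. k \<ge> K \<Longrightarrow> a (Suc k) \<le> a k" and lim: "a \<longlonglongrightarrow> 0"
  shows dirichlet_test_summable: "summable (\<lambda>k. f k * a k)"
    and dirichlet_test_tail:
      "m \<ge> K \<Longrightarrow> \<bar>(\<Sum>k. f k * a k) - (\<Sum>k<m. f k * a k)\<bar> \<le> B * a m"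
proof -
  have anti: "a n \<le> a k" if "K \<le> k" "k \<le> n" for k n
    using that(2)
  proof (induction n rule: dec_induct)
    case (step n)
    then show ?case using dec[of n] that(1) by linarith
  qed simp
  have nonneg: "a k \<ge> 0" if "k \<ge> K" for k
  proof (rule tendsto_upperbound[OF lim])
    show "\<forall>\<^sub>F n in sequentially. a n \<le> a k"
      using anti[OF that] by (auto simp: eventually_at_top_linorder)
  qed simp
  have "B \<ge> 0" using bound[of 0 0] by auto
  have part: "\<bar>\<Sum>k=m..<n. f k * a k\<bar> \<le> B * a m" if "m \<ge> K" for m n
    by (rule abs_sum_monotone_weights_le) (use that bound dec nonneg in auto)
  show sum: "summable (\<lambda>k. f k * a k)"
  proof (subst summable_Cauchy, intro allI impI)
    fix e :: real assume "e > 0"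
    have "(\<lambda>k. B * a k) \<longlonglongrightarrow> B * 0" by (intro tendsto_intros lim)
    then have "\<forall>\<^sub>F k in sequentially. B * a k < e"
      using \<open>e > 0\<close> by (simp add: order_tendstoD)
    then obtain N where "\<And>k. k \<ge> N \<Longrightarrow> B * a k < e"
      by (auto simp: eventually_at_top_linorder)
    then show "\<exists>N. \<forall>m\<ge>N. \<forall>n. norm (\<Sum>k=m..<n. f k * a k) < e"
      using part by (intro exI[of _ "max N K"]) (auto intro: order.strict_trans1)
  qed
  show "\<bar>(\<Sum>k. f k * a k) - (\<Sum>k<m. f k * a k)\<bar> \<le> B * a m" if "m \<ge> K"
  proof (rule tendsto_upperbound)
    show "(\<lambda>n. \<bar>(\<Sum>k<n. f k * a k) - (\<Sum>k<m. f k * a k)\<bar>)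
        \<longlonglongrightarrow> \<bar>(\<Sum>k. f k * a k) - (\<Sum>k<m. f k * a k)\<bar>"
      by (intro tendsto_intros summable_LIMSEQ sum)
    have "\<bar>(\<Sum>k<n. f k * a k) - (\<Sum>k<m. f k * a k)\<bar> \<le> B * a m" if "n \<ge> m" for n
      using part[OF \<open>m \<ge> K\<close>, of n] that
      by (simp add: sum_diff_nat_ivl lessThan_atLeast0)
    then show "\<forall>\<^sub>F n in sequentially. \<bar>(\<Sum>k<n. f k * a k) - (\<Sum>k<m. f k * a k)\<bar> \<le> B * a m"
      by (auto simp: eventually_at_top_linorder)
  qed simp
qed

text \<open>Absolute convergence allows summation along the hyperbolas a * b = n. Both Lambert
  series and Dirichlet products are rearranged in this way.\<close>

lemma has_sum_divisor_regroup:
  fixes h :: "nat \<times> nat \<Rightarrow> real"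
  assumes "h summable_on {1..} \<times> {1..}"
  shows "((\<lambda>n. \<Sum>d | d dvd n. h (n div d, d)) has_sum (\<Sum>\<^sub>\<infinity>a\<in>{1..}. \<Sum>\<^sub>\<infinity>b\<in>{1..}. h (a, b))) {1..}"
proof -
  have s: "h summable_on {1..} \<times> {1..}"
    by (fact assms)
  have eq: "(\<Sum>\<^sub>\<infinity>a\<in>{1..}. \<Sum>\<^sub>\<infinity>b\<in>{1..}. h (a, b)) = infsum h ({1..} \<times> {1..})"
    using infsum_Sigma'_banach[of "\<lambda>a b. h (a, b)" "{1..}" "\<lambda>_. {1..}"] s by simp
  have "(h has_sum infsum h ({1..} \<times> {1..})) ({1..} \<times> {1..})"
    using s by (rule has_sum_infsum)
  also have "?this \<longleftrightarrow> ((\<lambda>(n, d). h (n div d, d)) has_sum infsum h ({1..} \<times> {1..}))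
      (Sigma {1..} (\<lambda>n. {d. d dvd n}))"
    by (rule has_sum_reindex_bij_witness[where j = "\<lambda>(a, b). (a * b, b)" and i = "\<lambda>(n, d). (n div d, d)"])
       (auto simp: dvd_div_mult_self Suc_le_eq div_greater_zero_iff dvd_imp_le intro!: Nat.gr0I)
  finally have *: "((\<lambda>(n, d). h (n div d, d)) has_sum infsum h ({1..} \<times> {1..}))
      (Sigma {1..} (\<lambda>n. {d. d dvd n}))" .
  show ?thesis unfolding eq
    by (rule has_sum_SigmaD[OF *]) (auto intro!: has_sum_finite)
qed

section \<open>Completely multiplicative functions with values -1, 0, 1 and their divisor
  sums\<close>

text \<open>Neither a period nor a vanishing sum is assumed, so the constant 1 is an instance; it
  supplies the zeta series.\<close>

locale real_character =
  fixes \<psi> :: "nat \<Rightarrow> real"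
  assumes mult: "\<psi> (a * b) = \<psi> a * \<psi> b"
    and one: "\<psi> 1 = 1"
    and range: "\<psi> n \<in> {-1, 0, 1}"
begin

lemma power: "\<psi> (a ^ k) = \<psi> a ^ k"
  by (induction k) (use one in \<open>auto simp: mult\<close>)

lemma abs_le_1: "\<bar>\<psi> n\<bar> \<le> 1"
  using range[of n] by auto

lemma sum_divisors_coprime:
  assumes "coprime a b" "a > 0" "b > 0"
  shows "(\<Sum>d | d dvd a * b. \<psi> d) = (\<Sum>d | d dvd a. \<psi> d) * (\<Sum>d | d dvd b. \<psi> d)"
proof -
  have gcds: "gcd (x * y) a = x" "gcd (x * y) b = y" if "x dvd a" "y dvd b" for x y
  proof -
    have "coprime a y" "coprime b x"
      using that assms(1) by (meson coprime_divisors dvd_refl coprime_commute)+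
    then show "gcd (x * y) a = x" "gcd (x * y) b = y"
      using that by (simp_all add: gcd_mult_left_right_cancel gcd_mult_left_left_cancel gcd_nat.absorb1)
  qed
  have "(\<Sum>d | d dvd a * b. \<psi> d) = (\<Sum>(x, y)\<in>{d. d dvd a} \<times> {d. d dvd b}. \<psi> (x * y))"
  proof (rule sum.reindex_bij_witness[where j = "\<lambda>d. (gcd d a, gcd d b)" and i = "\<lambda>(x, y). x * y"])
    fix d assume "d \<in> {d. d dvd a * b}"
    then obtain x y where "d = x * y" "x dvd a" "y dvd b"
      using division_decomp[of d a b] by auto
    then show "(case (gcd d a, gcd d b) of (x, y) \<Rightarrow> x * y) = d"
      "(case (gcd d a, gcd d b) of (x, y) \<Rightarrow> \<psi> (x * y)) = \<psi> d"
      using gcds[of x y] by auto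
  next
    fix xy assume "xy \<in> {d. d dvd a} \<times> {d. d dvd b}"
    then show "(gcd (case xy of (x, y) \<Rightarrow> x * y) a, gcd (case xy of (x, y) \<Rightarrow> x * y) b) = xy"
      "(case xy of (x, y) \<Rightarrow> x * y) \<in> {d. d dvd a * b}"
      using gcds by (auto simp: mult_dvd_mono)
  qed auto
  also have "\<dots> = (\<Sum>d | d dvd a. \<psi> d) * (\<Sum>d | d dvd b. \<psi> d)"
    by (simp add: sum_product sum.cartesian_product mult case_prod_beta)
  finally show ?thesis .
qed

lemma sum_divisors_prime_power:
  assumes "prime p"
  shows "(\<Sum>d | d dvd p ^ k. \<psi> d) = (\<Sum>i\<le>k. \<psi> p ^ i)"
proof -
  have "{d. d dvd p ^ k} = (\<lambda>i. p ^ i) ` {..k}"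
    using divides_primepow_nat[OF assms] by auto
  moreover have "inj_on (\<lambda>i. p ^ i) {..k}"
    using prime_gt_1_nat[OF assms] by (auto intro!: inj_onI)
  ultimately show ?thesis
    by (simp add: sum.reindex power)
qed

lemma sum_powers_nonneg: "(\<Sum>i\<le>k. \<psi> p ^ i) \<ge> 0"
  and sum_even_powers_ge_1: "(\<Sum>i\<le>2 * k. \<psi> p ^ i) \<ge> 1"
proof -
  have alt: "(\<Sum>i\<le>k. (-1) ^ i :: real) = (if even k then 1 else 0)" for k
    by (induction k) auto
  have zero: "(\<Sum>i\<le>k. 0 ^ i :: real) = 1" for k
    by (induction k) auto
  show "(\<Sum>i\<le>k. \<psi> p ^ i) \<ge> 0"
    using range[of p] alt[of k] zero[of k] by auto
  show "(\<Sum>i\<le>2 * k. \<psi> p ^ i) \<ge> 1"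
    using range[of p] alt[of "2 * k"] zero[of "2 * k"] by auto
qed

text \<open>The divisor sum is multiplicative, and at p ^ k it equals k + 1, 1, or the indicator of
  even k, according as \<psi> p is 1, 0 or -1. All exponents of a square are even, so each of its
  local factors is at least 1.\<close>

lemma sum_divisors_bounds:
  assumes "n > 0"
  shows sum_divisors_nonneg: "(\<Sum>d | d dvd n. \<psi> d) \<ge> 0"
    and sum_divisors_square: "(\<Sum>d | d dvd n\<^sup>2. \<psi> d) \<ge> 1"
proof -
  have "(\<Sum>d | d dvd n. \<psi> d) \<ge> 0 \<and> (\<Sum>d | d dvd n\<^sup>2. \<psi> d) \<ge> 1"
    using assms
  proof (induction n rule: less_induct)
    case (less n)
    show ?case
    proof (cases "n = 1")
      case True
      have "{d :: nat. d dvd 1} = {1}" by auto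
      then show ?thesis using True one by simp
    next
      case False
      then obtain p where p: "prime p" "p dvd n"
        using prime_factor_nat by blast
      define k where "k = multiplicity p n"
      obtain m where m: "n = p ^ k * m" "\<not> p dvd m"
        using multiplicity_decompose'[of n p] p less.prems unfolding k_def
        by (metis less_numeral_extra(3) not_prime_unit)
      have "k > 0"
        using m p(2) by (cases k) auto
      then have "m < n" "m > 0"
        using m less.prems one_less_power[OF prime_gt_1_nat[OF p(1)], of k] by auto
      have cop: "coprime (p ^ j) (m ^ i)" for i j
        using p(1) m(2) by (simp add: prime_imp_coprime)
      have IH: "(\<Sum>d | d dvd m. \<psi> d) \<ge> 0" "(\<Sum>d | d dvd m\<^sup>2. \<psi> d) \<ge> 1"
        using less.IH[OF \<open>m < n\<close> \<open>m > 0\<close>] by auto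
      have 1: "(\<Sum>d | d dvd n. \<psi> d) = (\<Sum>i\<le>k. \<psi> p ^ i) * (\<Sum>d | d dvd m. \<psi> d)"
        using sum_divisors_coprime[OF cop[of k 1]] sum_divisors_prime_power[OF p(1), of k] m(1)
          \<open>m > 0\<close> p(1) prime_gt_0_nat by simp
      have "n\<^sup>2 = p ^ (2 * k) * m\<^sup>2"
        by (simp add: m(1) power_mult_distrib power_mult mult.commute)
      then have 2: "(\<Sum>d | d dvd n\<^sup>2. \<psi> d) = (\<Sum>i\<le>2 * k. \<psi> p ^ i) * (\<Sum>d | d dvd m\<^sup>2. \<psi> d)"
        using sum_divisors_coprime[OF cop[of "2 * k" 2]] sum_divisors_prime_power[OF p(1), of "2 * k"]
          \<open>m > 0\<close> p(1) prime_gt_0_nat by simp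
      have "1 * 1 \<le> (\<Sum>i\<le>2 * k. \<psi> p ^ i) * (\<Sum>d | d dvd m\<^sup>2. \<psi> d)"
        using sum_even_powers_ge_1[where k = k and p = p] IH(2) by (intro mult_mono) auto
      then show ?thesis
        unfolding 1 2 using sum_powers_nonneg IH(1) by simp
    qed
  qed
  then show "(\<Sum>d | d dvd n. \<psi> d) \<ge> 0" "(\<Sum>d | d dvd n\<^sup>2. \<psi> d) \<ge> 1" by auto
qed

end

text \<open>Being nonprincipal enters as a vanishing sum over a period, which bounds all interval
  sums and so makes Dirichlet's test applicable.\<close>

locale nonprincipal_real_character = real_character +
  fixes M :: nat
  assumes period: "\<psi> (n + M) = \<psi> n" and M_pos: "M > 0" and sum_period: "(\<Sum>n<M. \<psi> n) = 0"
begin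

lemma abs_partial_sum_le: "\<bar>\<Sum>k<n. \<psi> k\<bar> \<le> M"
proof (induction n rule: less_induct)
  case (less n)
  show ?case
  proof (cases "n < M")
    case True
    have "\<bar>\<Sum>k<n. \<psi> k\<bar> \<le> (\<Sum>k<n. 1)"
      using abs_le_1 by (intro order.trans[OF sum_abs] sum_mono) auto
    then show ?thesis using True by simp
  next
    case False
    then obtain m where m: "n = M + m" using le_Suc_ex not_less by blast
    have "(\<Sum>k<M + m. \<psi> k) = (\<Sum>k<M. \<psi> k) + (\<Sum>k<m. \<psi> (k + M))"
      by (induction m) (auto simp: add.commute)
    then have "(\<Sum>k<n. \<psi> k) = (\<Sum>k<m. \<psi> k)"
      by (simp add: m period sum_period)
    then show ?thesis using less[of m] m M_pos by simp
  qed
qed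

lemma abs_interval_sum_le: "\<bar>\<Sum>k=m..<n. \<psi> k\<bar> \<le> 2 * M"
proof (cases "m \<le> n")
  case True
  have "(\<Sum>k=m..<n. \<psi> k) = (\<Sum>k<n. \<psi> k) - (\<Sum>k<m. \<psi> k)"
    using sum_diff_nat_ivl[of 0 m n \<psi>] True by (simp add: lessThan_atLeast0)
  then show ?thesis using abs_partial_sum_le[of n] abs_partial_sum_le[of m] by linarith
qed simp

end

section \<open>Lambert series and the nonvanishing of L(1, \<psi>)\<close>

lemma geometric_has_sum_multiples:
  fixes t :: real
  assumes "0 < t" "t < 1" "a > 0"
  shows "((\<lambda>b. t ^ (a * b)) has_sum (t ^ a / (1 - t ^ a))) {1..}"
proof -
  have lt: "t ^ a < 1" using assms by (simp add: power_less_one_iff)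
  have "((\<lambda>b. (t ^ a) ^ b) has_sum (1 / (1 - t ^ a))) UNIV"
    using assms lt by (intro sums_nonneg_imp_has_sum geometric_sums) auto
  then have "((\<lambda>b. t ^ a * (t ^ a) ^ b) has_sum (t ^ a * (1 / (1 - t ^ a)))) UNIV"
    by (rule has_sum_cmult_right)
  also have "?this \<longleftrightarrow> ((\<lambda>b. t ^ (a * b)) has_sum (t ^ a / (1 - t ^ a))) {1..}"
    by (rule has_sum_reindex_bij_witness[where j = Suc and i = "\<lambda>n. n - 1"])
       (auto simp: power_add power_mult)
  finally show ?thesis .
qed

lemma summable_on_power_mult_pairs:
  fixes t :: real
  assumes "0 < t" "t < 1"
  shows "(\<lambda>(a, b). t ^ (a * b)) summable_on {1..} \<times> {1..}"
proof (rule summable_on_SigmaI)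
  show "((\<lambda>b. case (a, b) of (a, b) \<Rightarrow> t ^ (a * b)) has_sum (t ^ a / (1 - t ^ a))) {1..}"
    if "a \<in> {1..}" for a
    using geometric_has_sum_multiples[OF assms, of a] that by simp
  show "(\<lambda>a. t ^ a / (1 - t ^ a)) summable_on {1..}"
  proof (rule summable_on_comparison_test)
    have "(\<lambda>b. t ^ (1 * b)) summable_on {1..}"
      using geometric_has_sum_multiples[OF assms, of 1] by (auto simp: summable_on_def)
    then show "(\<lambda>a. t ^ a * (1 / (1 - t))) summable_on {1..}"
      by (intro summable_on_cmult_left) simp
    fix a :: nat assume "a \<in> {1..}"
    then have "t ^ a \<le> t ^ 1" using assms by (intro power_decreasing) auto
    then show "t ^ a / (1 - t ^ a) \<le> t ^ a * (1 / (1 - t))"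
      using assms by (simp add: frac_le)
    show "0 \<le> t ^ a / (1 - t ^ a)"
      using \<open>t ^ a \<le> t ^ 1\<close> assms by simp
  qed
qed (use assms in auto)

lemma has_sum_atLeast_1_imp_sums:
  fixes f :: "nat \<Rightarrow> real"
  assumes "(f has_sum S) {1..}" "f 0 = 0"
  shows "f sums S"
proof -
  have "(f has_sum S) UNIV \<longleftrightarrow> (f has_sum S) {1..}"
    by (rule has_sum_cong_neutral) (use assms(2) in \<open>auto simp: Suc_le_eq\<close>)
  then show ?thesis using assms(1) has_sum_imp_sums by blast
qed

text \<open>Expanding the geometric series turns the Lambert series into a power series whose
  coefficients are the divisor sums of \<psi>. These are nonnegative and at least 1 at squares, so
  the squares up to K^2 alone contribute K * t ^ K^2, which is arbitrarily large for suitable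
  \<open>K\<close> and \<open>t\<close> near 1.\<close>

lemma (in real_character) lambert_sum_ge:
  assumes "0 < t" "t < 1"
  obtains S where "(\<lambda>n. \<psi> n * (t ^ n / (1 - t ^ n))) sums S" "S \<ge> K * t ^ K\<^sup>2"
proof -
  define h where "h = (\<lambda>(a, b). \<psi> a * t ^ (a * b))"
  have "h summable_on {1..} \<times> {1..}"
  proof (rule Infinite_Sum.abs_summable_summable, rule Infinite_Sum.abs_summable_on_comparison_test')
    show "(\<lambda>(a, b). t ^ (a * b)) summable_on {1..} \<times> {1..}"
      by (rule summable_on_power_mult_pairs[OF assms])
  qed (use assms abs_le_1 in \<open>auto simp: h_def abs_mult intro!: mult_left_le_one_le\<close>)
  define S where "S = (\<Sum>\<^sub>\<infinity>a\<in>{1..}. \<Sum>\<^sub>\<infinity>b\<in>{1..}. h (a, b))"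
  have inner: "((\<lambda>b. h (a, b)) has_sum (\<psi> a * (t ^ a / (1 - t ^ a)))) {1..}" if "a \<in> {1..}" for a
    unfolding h_def prod.case
    using geometric_has_sum_multiples[OF assms, of a] that by (intro has_sum_cmult_right) auto
  have "(h has_sum infsum h ({1..} \<times> {1..})) ({1..} \<times> {1..})"
    using \<open>h summable_on _\<close> by (rule has_sum_infsum)
  then have *: "((\<lambda>a. \<psi> a * (t ^ a / (1 - t ^ a))) has_sum infsum h ({1..} \<times> {1..})) {1..}"
    by (rule has_sum_SigmaD) (use inner in auto)
  moreover have "S = infsum h ({1..} \<times> {1..})"
    unfolding S_def using infsum_Sigma'_banach[of "\<lambda>a b. h (a, b)" "{1..}" "\<lambda>_. {1..}"]
      \<open>h summable_on _\<close> by simp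
  ultimately have 1: "((\<lambda>a. \<psi> a * (t ^ a / (1 - t ^ a))) has_sum S) {1..}" by simp
  have regroup: "(\<Sum>d | d dvd n. h (n div d, d)) = (\<Sum>d | d dvd n. \<psi> d) * t ^ n" if "n > 0" for n
  proof -
    have "(\<Sum>d | d dvd n. h (n div d, d)) = (\<Sum>d | d dvd n. \<psi> (n div d) * t ^ n)"
      by (intro sum.cong) (auto simp: h_def)
    also have "\<dots> = (\<Sum>d | d dvd n. \<psi> d * t ^ n)"
      by (rule sum.reindex_bij_witness[where j = "\<lambda>d. n div d" and i = "\<lambda>d. n div d"])
         (use that in \<open>auto simp: div_div_eq_right\<close>)
    finally show ?thesis by (simp add: sum_distrib_right)
  qed
  have 2: "((\<lambda>n. (\<Sum>d | d dvd n. \<psi> d) * t ^ n) has_sum S) {1..}"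
    unfolding S_def using has_sum_divisor_regroup[OF \<open>h summable_on _\<close>]
    by (rule has_sum_cong[THEN iffD1, rotated]) (use regroup in auto)
  have "real K * t ^ K\<^sup>2 = (\<Sum>k=1..K. t ^ K\<^sup>2)"
    by simp
  also have "\<dots> \<le> (\<Sum>k=1..K. (\<Sum>d | d dvd k\<^sup>2. \<psi> d) * t ^ k\<^sup>2)"
  proof (rule sum_mono)
    fix k assume k: "k \<in> {1..K}"
    have "1 * t ^ K\<^sup>2 \<le> (\<Sum>d | d dvd k\<^sup>2. \<psi> d) * t ^ k\<^sup>2"
      using sum_divisors_square[of k] k assms
      by (intro mult_mono power_decreasing power_mono) auto
    then show "t ^ K\<^sup>2 \<le> (\<Sum>d | d dvd k\<^sup>2. \<psi> d) * t ^ k\<^sup>2" by simp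
  qed
  also have "\<dots> = (\<Sum>n\<in>(\<lambda>k. k\<^sup>2) ` {1..K}. (\<Sum>d | d dvd n. \<psi> d) * t ^ n)"
    by (subst sum.reindex) (auto intro!: inj_onI simp: power2_eq_iff_nonneg)
  also have "\<dots> \<le> S"
    by (rule finite_sum_le_has_sum[OF 2])
       (use assms sum_divisors_nonneg in \<open>auto simp: Suc_le_eq\<close>)
  finally have ge: "S \<ge> K * t ^ K\<^sup>2" .
  show ?thesis
    by (rule that[OF has_sum_atLeast_1_imp_sums[OF 1] ge]) simp
qed

text \<open>This is \<open>1 + t + \<dots> + t^(n-1) \<ge> n t^((n-1)/2)\<close>, squared to avoid roots.\<close>
lemma sum_powers_sq_ge:
  fixes t :: real
  assumes "0 < t"
  shows "(\<Sum>i<n. t ^ i)\<^sup>2 * t \<ge> (real n)\<^sup>2 * t ^ n"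
proof -
  \<comment> \<open>One factor is read backwards, so that the terms at (i, j) and (j, i) have
    exponents n + i - j and n + j - i with mean n; AM-GM then applies to each such pair.\<close>
  have "(\<Sum>i<n. t ^ i)\<^sup>2 * t = (\<Sum>i<n. t ^ i) * (\<Sum>i<n. t ^ (n - Suc i)) * t"
    by (simp add: sum.nat_diff_reindex power2_eq_square)
  also have "\<dots> = (\<Sum>i<n. \<Sum>j<n. t ^ (i + (n - Suc j) + 1))"
    unfolding sum_product by (simp only: sum_distrib_right power_add power_one_right)
  finally have eq: "(\<Sum>i<n. t ^ i)\<^sup>2 * t = (\<Sum>i<n. \<Sum>j<n. t ^ (i + (n - Suc j) + 1))" .
  have amgm: "t ^ (n + i - j) + t ^ (n + j - i) \<ge> 2 * t ^ n" if "i < n" "j < n" for i j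
  proof -
    have sq: "x\<^sup>2 + y\<^sup>2 \<ge> 2 * x * y" for x y :: real
      using sum_squares_bound[of x y] by simp
    have "sqrt t ^ (n + i - j) * sqrt t ^ (n + j - i) = sqrt t ^ (2 * n)"
      using that by (simp add: power_add[symmetric] mult_2)
    then have "sqrt t ^ (n + i - j) * sqrt t ^ (n + j - i) = t ^ n"
      using assms by (simp add: power_mult)
    moreover have "(sqrt t ^ k)\<^sup>2 = t ^ k" for k
      using assms by (simp add: power2_eq_square power_mult_distrib[symmetric])
    ultimately show ?thesis
      using sq[of "sqrt t ^ (n + i - j)" "sqrt t ^ (n + j - i)"] by (simp add: mult.assoc)
  qed
  define A where "A = (\<Sum>i<n. \<Sum>j<n. t ^ (n + i - j))"
  have "(\<Sum>i<n. \<Sum>j<n. t ^ (i + (n - Suc j) + 1)) = A"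
    unfolding A_def by (intro sum.cong refl) (auto simp: Suc_diff_Suc intro!: arg_cong[where f = "\<lambda>k. t ^ k"])
  have "A = (\<Sum>i<n. \<Sum>j<n. t ^ (n + j - i))"
    unfolding A_def by (rule sum.swap)
  then have "2 * A = (\<Sum>i<n. \<Sum>j<n. t ^ (n + i - j) + t ^ (n + j - i))"
    by (simp add: A_def sum.distrib)
  also have "\<dots> \<ge> (\<Sum>i<n. \<Sum>j<n. 2 * t ^ n)"
    by (intro sum_mono) (use amgm in auto)
  finally have "A \<ge> (real n)\<^sup>2 * t ^ n"
    by (simp add: power2_eq_square)
  then show ?thesis
    using eq \<open>_ = A\<close> by simp
qed

text \<open>These weights measure the difference between L(1, \<psi>) / (1 - t) and the Lambert
  series. With 1 - t^n = (1 - t) * G n, the claim becomes n * (n + 1) * t^n \<le> G n * G (n + 1),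
  which follows from the product of \<open>sum_powers_sq_ge\<close> at n and at n + 1.\<close>

lemma lambert_weight_antimono:
  fixes t :: real
  assumes "0 < t" "t < 1" "n > 0"
  shows "1 / (Suc n * (1 - t)) - t ^ Suc n / (1 - t ^ Suc n) \<le> 1 / (n * (1 - t)) - t ^ n / (1 - t ^ n)"
proof -
  define G where "G n = (\<Sum>i<n. t ^ i)" for n
  have G: "1 - t ^ k = (1 - t) * G k" for k
    unfolding G_def using assms by (simp add: one_diff_power_eq)
  have Gpos: "G k > 0" if "k > 0" for k
    unfolding G_def using that assms by (intro sum_pos) auto
  have "(real n * real (Suc n) * t ^ n)\<^sup>2 \<le> (G n * G (Suc n))\<^sup>2"
  proof -
    have "((real n)\<^sup>2 * t ^ n) * ((real (Suc n))\<^sup>2 * t ^ Suc n) \<le> ((G n)\<^sup>2 * t) * ((G (Suc n))\<^sup>2 * t)"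
      unfolding G_def using assms
      by (intro mult_mono[OF sum_powers_sq_ge sum_powers_sq_ge]) auto
    then have "t * ((real n * real (Suc n))\<^sup>2 * (t ^ n * t ^ n)) \<le> t * ((G n * G (Suc n))\<^sup>2 * t)"
      by (simp add: power_mult_distrib algebra_simps power2_eq_square)
    then have "(real n * real (Suc n) * t ^ n)\<^sup>2 \<le> (G n * G (Suc n))\<^sup>2 * t"
      using assms by (simp add: power_mult_distrib power2_eq_square mult_ac)
    also have "\<dots> \<le> (G n * G (Suc n))\<^sup>2"
      using assms by (simp add: mult_left_le)
    finally show ?thesis .
  qed
  then have le: "real n * real (Suc n) * t ^ n \<le> G n * G (Suc n)"
    using Gpos[of n] Gpos[of "Suc n"] assms by (meson less_imp_le mult_pos_pos power2_le_imp_le zero_less_Suc)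
  have "t ^ n / G n - t ^ Suc n / G (Suc n) = t ^ n * (G (Suc n) - t * G n) / (G n * G (Suc n))"
    using Gpos[of n] Gpos[of "Suc n"] assms by (simp add: field_simps)
  also have "G (Suc n) - t * G n = 1"
    using G[of "Suc n"] G[of n] assms(2) unfolding G_def sum.lessThan_Suc_shift
    by (simp add: sum_distrib_left)
  also have "t ^ n * 1 / (G n * G (Suc n)) \<le> 1 / (real n * real (Suc n))"
  proof -
    have "t ^ n \<le> G n * G (Suc n) / (real n * real (Suc n))"
      using le assms(3) by (simp add: pos_le_divide_eq mult_ac del: of_nat_Suc)
    then show ?thesis
      using Gpos[of n] Gpos[of "Suc n"] assms(3) by (simp add: pos_divide_le_eq del: of_nat_Suc)
  qed
  also have "1 / (real n * real (Suc n)) = 1 / n - 1 / Suc n"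
    using assms(3) by (simp add: field_simps)
  finally have "(t ^ n / G n - t ^ Suc n / G (Suc n)) / (1 - t) \<le> (1 / n - 1 / Suc n) / (1 - t)"
    using assms by (intro divide_right_mono) auto
  then show ?thesis
    unfolding G by (simp add: diff_divide_distrib mult.commute)
qed

lemma inverse_multiple_tendsto_0: "(\<lambda>n. 1 / (real n * c)) \<longlonglongrightarrow> 0"
proof -
  have "(\<lambda>n. inverse (real n) * inverse c) \<longlonglongrightarrow> 0 * inverse c"
    by (intro tendsto_intros lim_inverse_n)
  then show ?thesis by (simp add: field_simps)
qed

context nonprincipal_real_character
begin

lemma summable_over_n: "summable (\<lambda>n. \<psi> n * (1 / n))"
  by (rule dirichlet_test_summable[where K = 1, OF abs_interval_sum_le])
     (use inverse_multiple_tendsto_0[of 1] in \<open>auto simp: frac_le\<close>)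

text \<open>If L(1, \<psi>) were 0, the Lambert series would be minus the sum of \<psi> n * b n.
  Dirichlet's test bounds the latter by 2 * M for every t, whereas \<open>lambert_sum_ge\<close>
  makes the former unbounded.\<close>

lemma L_1_nonzero: "(\<Sum>n. \<psi> n * (1 / n)) \<noteq> 0"
proof
  assume L0: "(\<Sum>n. \<psi> n * (1 / n)) = 0"
  \<comment> \<open>With t ^ K^2 > 1/2 the Lambert series is at least K/2, just above the bound 2 *
    M.\<close>
  define K where "K = 4 * M + 1"
  have "((\<lambda>t. t ^ K\<^sup>2 :: real) \<longlongrightarrow> 1 ^ K\<^sup>2) (at_left 1)"
    by (intro tendsto_intros)
  then have "\<forall>\<^sub>F t in at_left (1::real). t ^ K\<^sup>2 > 1 / 2"
    by (rule order_tendstoD) auto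
  moreover have "\<forall>\<^sub>F t in at_left (1::real). t \<in> {0<..<1}"
    by (rule eventually_at_left_real) simp
  ultimately have "\<forall>\<^sub>F t in at_left (1::real). t ^ K\<^sup>2 > 1 / 2 \<and> t \<in> {0<..<1}"
    by (rule eventually_conj)
  then have "\<exists>t::real. t ^ K\<^sup>2 > 1 / 2 \<and> t \<in> {0<..<1}"
    by (rule eventually_happens'[OF trivial_limit_at_left_real])
  then obtain t :: real where t: "0 < t" "t < 1" "t ^ K\<^sup>2 > 1 / 2"
    unfolding greaterThanLessThan_iff by blast
  obtain S where S: "(\<lambda>n. \<psi> n * (t ^ n / (1 - t ^ n))) sums S" "S \<ge> K * t ^ K\<^sup>2"
    using lambert_sum_ge[OF t(1,2), where K = K] by blast
  define b where "b n = 1 / (real n * (1 - t)) - t ^ n / (1 - t ^ n)" for n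
  have "(\<lambda>n. 1 / (real n * (1 - t)) - t ^ n / (1 - t ^ n)) \<longlonglongrightarrow> 0 - 0 / (1 - 0)"
    using t by (intro tendsto_intros inverse_multiple_tendsto_0 LIMSEQ_realpow_zero) auto
  then have lim: "b \<longlonglongrightarrow> 0"
    by (simp add: b_def[abs_def])
  have dec: "b (Suc n) \<le> b n" if "n \<ge> 1" for n
    unfolding b_def using lambert_weight_antimono[OF t(1,2), of n] that by simp
  have "\<bar>(\<Sum>n. \<psi> n * b n) - (\<Sum>n<1. \<psi> n * b n)\<bar> \<le> 2 * M * b 1"
    by (rule dirichlet_test_tail[where K = 1, OF abs_interval_sum_le dec lim]) auto
  moreover have "b 0 = 0" by (simp add: b_def)
  moreover have "b 1 = 1" using t by (simp add: b_def diff_divide_distrib[symmetric])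
  ultimately have bound: "\<bar>\<Sum>n. \<psi> n * b n\<bar> \<le> 2 * M"
    by simp
  have "(\<lambda>n. (1 / (1 - t)) * (\<psi> n * (1 / n)) - \<psi> n * (t ^ n / (1 - t ^ n))) sums ((1 / (1 - t)) * 0 - S)"
    using summable_sums[OF summable_over_n] L0 by (intro sums_diff sums_mult S(1)) simp
  moreover have "(1 / (1 - t)) * (\<psi> n * (1 / n)) - \<psi> n * (t ^ n / (1 - t ^ n)) = \<psi> n * b n" for n
    by (simp add: b_def right_diff_distrib) (simp add: algebra_simps)
  ultimately have "(\<lambda>n. \<psi> n * b n) sums (- S)"
    by simp
  then have "S \<le> 2 * M"
    using bound by (simp add: sums_iff)
  moreover have "K * t ^ K\<^sup>2 \<ge> K * (1 / 2)"
    using t(3) by (intro mult_left_mono) auto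
  ultimately have "real K * (1 / 2) \<le> 2 * M"
    using S(2) by linarith
  then show False by (simp add: K_def)
qed

end

section \<open>Dirichlet products and the von Mangoldt series\<close>

lemma sums_dirichlet_product:
  fixes f g :: "nat \<Rightarrow> real"
  assumes f: "summable (\<lambda>n. \<bar>f n\<bar>)" and g: "summable (\<lambda>n. \<bar>g n\<bar>)"
    and f0: "f 0 = 0" and g0: "g 0 = 0"
  shows "(\<lambda>n. \<Sum>d | d dvd n. f (n div d) * g d) sums (suminf f * suminf g)"
proof -
  have on_pos: "(u has_sum suminf u) {1..}" if "summable (\<lambda>n. \<bar>u n\<bar>)" "u 0 = 0" for u :: "nat \<Rightarrow> real"
  proof -
    have "(u has_sum suminf u) UNIV"
      by (rule norm_summable_imp_has_sum) (use that summable_rabs_cancel in \<open>auto simp: summable_sums\<close>)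
    also have "?this \<longleftrightarrow> ?thesis"
      by (rule has_sum_cong_neutral) (use that(2) in \<open>auto simp: Suc_le_eq\<close>)
    finally show ?thesis .
  qed
  have abs_f: "((\<lambda>n. \<bar>f n\<bar>) has_sum (\<Sum>n. \<bar>f n\<bar>)) {1..}"
    and abs_g: "((\<lambda>n. \<bar>g n\<bar>) has_sum (\<Sum>n. \<bar>g n\<bar>)) {1..}"
    using on_pos[of "\<lambda>n. \<bar>f n\<bar>"] on_pos[of "\<lambda>n. \<bar>g n\<bar>"] f g f0 g0 by simp_all
  define h where "h = (\<lambda>(a, b). f a * g b)"
  have "(\<lambda>(a, b). \<bar>f a\<bar> * \<bar>g b\<bar>) summable_on {1..} \<times> {1..}"
  proof (rule summable_on_SigmaI)
    show "((\<lambda>b. case (a, b) of (a, b) \<Rightarrow> \<bar>f a\<bar> * \<bar>g b\<bar>) has_sum (\<bar>f a\<bar> * (\<Sum>n. \<bar>g n\<bar>))) {1..}" for a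
      unfolding prod.case by (rule has_sum_cmult_right[OF abs_g])
    show "(\<lambda>a. \<bar>f a\<bar> * (\<Sum>n. \<bar>g n\<bar>)) summable_on {1..}"
      using abs_f by (intro summable_on_cmult_left) (auto simp: summable_on_def)
  qed auto
  then have h: "h summable_on {1..} \<times> {1..}"
    by (rule Infinite_Sum.abs_summable_summable[OF Infinite_Sum.abs_summable_on_comparison_test'])
       (auto simp: h_def abs_mult)
  have "(\<Sum>\<^sub>\<infinity>a\<in>{1..}. \<Sum>\<^sub>\<infinity>b\<in>{1..}. h (a, b)) = suminf f * suminf g"
    using infsumI[OF on_pos[OF f f0]] infsumI[OF on_pos[OF g g0]]
    by (simp add: h_def infsum_cmult_right' infsum_cmult_left')
  then have "((\<lambda>n. \<Sum>d | d dvd n. h (n div d, d)) has_sum (suminf f * suminf g)) {1..}"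
    using has_sum_divisor_regroup[OF h] by simp
  then show ?thesis
    unfolding h_def prod.case by (rule has_sum_atLeast_1_imp_sums) simp
qed

lemma summable_powr_minus:
  "s > 1 \<Longrightarrow> summable (\<lambda>n. real n powr - s)"
  by (simp add: summable_real_powr_iff)

lemma summable_ln_powr_minus:
  fixes s :: real
  assumes "s > 1"
  shows "summable (\<lambda>n. ln (real n) * real n powr - s)"
proof (rule summable_comparison_test)
  define e where "e = (s - 1) / 2"
  have "e > 0" using assms by (simp add: e_def)
  show "summable (\<lambda>n. 1 / e * real n powr - (1 + e))"
    using \<open>e > 0\<close> by (intro summable_mult summable_powr_minus) simp
  have "norm (ln (real n) * real n powr - s) \<le> 1 / e * real n powr - (1 + e)" if "n \<ge> 1" for n
  proof -
    have "ln (real n) * real n powr - s \<le> real n powr e / e * real n powr - s"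
      using that \<open>e > 0\<close> by (intro mult_right_mono ln_powr_bound) auto
    also have "\<dots> = 1 / e * real n powr (e - s)"
      using that by (simp add: powr_diff powr_minus field_simps)
    also have "e - s = - (1 + e)" by (simp add: e_def field_simps)
    finally show ?thesis using that by simp
  qed
  then show "\<exists>N. \<forall>n\<ge>N. norm (ln (real n) * real n powr - s) \<le> 1 / e * real n powr - (1 + e)"
    by blast
qed

lemma summable_mangoldt_powr_minus:
  assumes "s > 1"
  shows "summable (\<lambda>n. mangoldt n * real n powr - s)"
proof (rule summable_comparison_test[OF _ summable_ln_powr_minus[OF assms]])
  show "\<exists>N. \<forall>n\<ge>N. norm (mangoldt n * real n powr - s) \<le> ln (real n) * real n powr - s"
    using mangoldt_le mangoldt_nonneg
    by (intro exI[of _ 1]) (auto simp: abs_mult intro!: mult_right_mono)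
qed

context real_character
begin

lemma summable_abs_mult:
  assumes "summable (\<lambda>n. \<bar>f n\<bar>)"
  shows "summable (\<lambda>n. \<bar>\<psi> n * f n\<bar>)"
  by (rule summable_comparison_test[OF _ assms])
     (use abs_le_1 in \<open>auto simp: abs_mult intro!: mult_left_le_one_le\<close>)

text \<open>This is L * (-L'/L) = -L' without derivatives: the sum of \<open>mangoldt\<close> over
  the divisors of n is ln n, and \<psi> passes through the convolution by complete
  multiplicativity.\<close>

lemma L_times_mangoldt_series:
  assumes "s > 1"
  shows "(\<Sum>n. \<psi> n * real n powr - s) * (\<Sum>n. \<psi> n * (mangoldt n * real n powr - s)) =
    (\<Sum>n. \<psi> n * (ln (real n) * real n powr - s))"
proof -
  have "(\<lambda>n. \<Sum>d | d dvd n. \<psi> (n div d) * real (n div d) powr - s * (\<psi> d * (mangoldt d * real d powr - s)))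
      sums ((\<Sum>n. \<psi> n * real n powr - s) * (\<Sum>n. \<psi> n * (mangoldt n * real n powr - s)))"
    using summable_powr_minus[OF assms] summable_mangoldt_powr_minus[OF assms] mangoldt_nonneg
    by (intro sums_dirichlet_product summable_abs_mult) (auto simp: abs_mult)
  moreover have "(\<Sum>d | d dvd n. \<psi> (n div d) * real (n div d) powr - s * (\<psi> d * (mangoldt d * real d powr - s)))
      = \<psi> n * (ln (real n) * real n powr - s)" for n
  proof (cases "n = 0")
    case False
    have "\<psi> (n div d) * real (n div d) powr - s * (\<psi> d * (mangoldt d * real d powr - s))
        = mangoldt d * (\<psi> n * real n powr - s)" if "d dvd n" for d
    proof -
      have "\<psi> n = \<psi> (n div d) * \<psi> d" "real n = real (n div d) * real d"
        using that mult[of "n div d" d] by (auto simp flip: of_nat_mult)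
      then show ?thesis by (simp add: powr_mult)
    qed
    then have "(\<Sum>d | d dvd n. \<psi> (n div d) * real (n div d) powr - s * (\<psi> d * (mangoldt d * real d powr - s)))
        = (\<Sum>d | d dvd n. mangoldt d) * (\<psi> n * real n powr - s)"
      unfolding sum_distrib_right by (intro sum.cong) auto
    then show ?thesis using mangoldt_sum[of n, where ?'a = real] False by simp
  qed simp
  ultimately show ?thesis by (simp add: sums_iff)
qed

end

section \<open>Nonprincipal characters as s tends to 1\<close>

context nonprincipal_real_character
begin

lemma powr_minus_weights:
  assumes "s \<ge> 1"
  shows powr_minus_dec: "k \<ge> 1 \<Longrightarrow> real (Suc k) powr - s \<le> real k powr - s"
    and powr_minus_lim: "(\<lambda>k. real k powr - s) \<longlonglongrightarrow> 0"
  using assms by (auto intro!: powr_mono2' tendsto_neg_powr filterlim_real_sequentially)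

text \<open>Continuity up to the endpoint carries L(1, \<psi>) \<noteq> 0 over to s slightly above
  1. The tails are at most 2 * M / m for all s \<ge> 1 at once, although at s = 1 convergence need
  not be absolute.\<close>

lemma L_continuous: "continuous_on {1..} (\<lambda>s. \<Sum>n. \<psi> n * real n powr - s)"
proof (rule uniform_limit_theorem[OF always_eventually])
  show "uniform_limit {1..} (\<lambda>m s. \<Sum>n<m. \<psi> n * real n powr - s)
      (\<lambda>s. \<Sum>n. \<psi> n * real n powr - s) sequentially"
  proof (rule uniform_limitI)
    fix e :: real assume "e > 0"
    have "(\<lambda>m. 2 * M * real m powr - 1) \<longlonglongrightarrow> real (2 * M) * 0"
      by (intro tendsto_intros powr_minus_lim) simp
    then have "\<forall>\<^sub>F m in sequentially. 2 * M * real m powr - 1 < e"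
      using \<open>e > 0\<close> by (intro order_tendstoD(2)) auto
    then show "\<forall>\<^sub>F m in sequentially. \<forall>s\<in>{1..}.
        dist (\<Sum>n<m. \<psi> n * real n powr - s) (\<Sum>n. \<psi> n * real n powr - s) < e"
      using eventually_ge_at_top[of 1]
    proof eventually_elim
      case (elim m)
      show ?case
      proof
        fix s :: real assume s: "s \<in> {1..}"
        have "\<bar>(\<Sum>n. \<psi> n * real n powr - s) - (\<Sum>n<m. \<psi> n * real n powr - s)\<bar> \<le> 2 * M * real m powr - s"
          using s elim powr_minus_weights[of s]
          by (intro dirichlet_test_tail[where K = 1, OF abs_interval_sum_le]) auto
        also have "real m powr - s \<le> real m powr - 1"
          using s elim by (intro powr_mono) auto
        finally show "dist (\<Sum>n<m. \<psi> n * real n powr - s) (\<Sum>n. \<psi> n * real n powr - s) < e"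
          using elim by (simp add: dist_real_def mult_left_mono)
      qed
    qed
  qed
next
  have "continuous_on {1..} (\<lambda>s. real n powr - s)" for n
    by (cases "n = 0") (auto intro!: continuous_intros)
  then show "\<forall>m. continuous_on {1..} (\<lambda>s. \<Sum>n<m. \<psi> n * real n powr - s)"
    by (intro allI continuous_on_sum continuous_on_mult continuous_on_const)
qed simp

lemma L_eventually_bounded_below:
  "\<exists>c>0. \<forall>\<^sub>F s in at_right 1. \<bar>\<Sum>n. \<psi> n * real n powr - s\<bar> \<ge> c"
proof -
  define L where "L s = (\<Sum>n. \<psi> n * real n powr - s)" for s
  have "L 1 \<noteq> 0"
    using L_1_nonzero by (simp add: L_def powr_minus_divide)
  have "(L \<longlongrightarrow> L 1) (at 1 within {1..})"
    using L_continuous unfolding L_def[abs_def] continuous_on_def by (rule bspec) simp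
  then have "(L \<longlongrightarrow> L 1) (at_right 1)"
    by (rule tendsto_within_subset) auto
  then have "((\<lambda>s. \<bar>L s\<bar>) \<longlongrightarrow> \<bar>L 1\<bar>) (at_right 1)"
    by (rule tendsto_rabs)
  then have "\<forall>\<^sub>F s in at_right 1. \<bar>L s\<bar> > \<bar>L 1\<bar> / 2"
    by (rule order_tendstoD) (use \<open>L 1 \<noteq> 0\<close> in auto)
  then have "\<forall>\<^sub>F s in at_right 1. \<bar>L s\<bar> \<ge> \<bar>L 1\<bar> / 2"
    by (rule eventually_mono) simp
  then show ?thesis
    using \<open>L 1 \<noteq> 0\<close> unfolding L_def by (intro exI[of _ "\<bar>L 1\<bar> / 2"]) (auto simp: L_def)
qed

text \<open>The weight factors as (ln k / k) * k^(1 - s). The first factor decreases only beyond e,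
  whence the start at 3.\<close>

lemma ln_powr_minus_weights:
  assumes "s \<ge> 1"
  shows ln_powr_minus_dec: "k \<ge> 3 \<Longrightarrow> ln (real (Suc k)) * real (Suc k) powr - s \<le> ln (real k) * real k powr - s"
    and ln_powr_minus_lim: "(\<lambda>k. ln (real k) * real k powr - s) \<longlonglongrightarrow> 0"
proof -
  assume k: "k \<ge> 3"
  have "ln (exp 1) \<le> ln (real k)"
    using k exp_le by (subst ln_le_cancel_iff) auto
  then have ln1: "1 \<le> ln (real k)" by simp
  have "ln (real (Suc k)) = ln (real k) + ln (1 + 1 / real k)"
  proof -
    have "real (Suc k) = real k * (1 + 1 / real k)"
      using k by (simp add: field_simps)
    moreover have "1 + 1 / real k > 0" by (simp add: add_pos_nonneg)
    ultimately show ?thesis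
      using k ln_mult[of "real k" "1 + 1 / real k"] by simp
  qed
  also have "\<dots> \<le> ln (real k) + 1 / real k"
    using k by (intro add_left_mono ln_add_one_self_le_self) auto
  also have "\<dots> \<le> ln (real k) * (real (Suc k) / real k)"
    using k ln1 by (simp add: field_simps)
  finally have 1: "ln (real (Suc k)) / real (Suc k) \<le> ln (real k) / real k"
    using k by (simp add: field_simps)
  have 2: "real (Suc k) powr (1 - s) \<le> real k powr (1 - s)"
    using k assms powr_mono2'[of "1 - s" "real k" "real (Suc k)"] by simp
  have eq: "ln (real j) * real j powr - s = ln (real j) / real j * real j powr (1 - s)" if "j > 0" for j
    using that by (simp add: powr_diff powr_minus field_simps)
  show "ln (real (Suc k)) * real (Suc k) powr - s \<le> ln (real k) * real k powr - s"
    using eq[of k] eq[of "Suc k"] mult_mono[OF 1 2] k by simp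
next
  show "(\<lambda>k. ln (real k) * real k powr - s) \<longlonglongrightarrow> 0"
  proof (rule tendsto_sandwich[OF _ _ tendsto_const lim_ln_over_n])
    show "\<forall>\<^sub>F n in sequentially. 0 \<le> ln (real n) * real n powr - s"
      by (auto simp: eventually_at_top_linorder intro!: exI[of _ 1])
    show "\<forall>\<^sub>F n in sequentially. ln (real n) * real n powr - s \<le> ln (real n) / real n"
    proof (rule eventually_mono[OF eventually_ge_at_top[of 1]])
      fix n :: nat assume n: "n \<ge> 1"
      have "ln (real n) * real n powr - s \<le> ln (real n) * real n powr - 1"
        using n assms by (intro mult_left_mono powr_mono) auto
      then show "ln (real n) * real n powr - s \<le> ln (real n) / real n"
        using n by (simp add: powr_minus_divide)
    qed
  qed
qed

lemma ln_series_bounded: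
  assumes "s \<ge> 1"
  shows "\<bar>\<Sum>n. \<psi> n * (ln (real n) * real n powr - s)\<bar> \<le> ln 2 + 2 * M * ln 3"
proof -
  have small: "real k powr - s \<le> 1" for k
    using assms powr_mono2'[of "- s" 1 "real k"] by (cases "k = 0") auto
  have "\<bar>(\<Sum>n. \<psi> n * (ln (real n) * real n powr - s)) - (\<Sum>n<3. \<psi> n * (ln (real n) * real n powr - s))\<bar>
      \<le> 2 * M * (ln (real 3) * real 3 powr - s)"
    using ln_powr_minus_weights[OF assms]
    by (intro dirichlet_test_tail[where K = 3, OF abs_interval_sum_le]) auto
  also have "\<dots> \<le> 2 * M * ln 3"
    using small[of 3] by (intro mult_left_mono) (auto simp: mult_left_le)
  finally have 1: "\<bar>(\<Sum>n. \<psi> n * (ln (real n) * real n powr - s)) - (\<Sum>n<3. \<psi> n * (ln (real n) * real n powr - s))\<bar>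
      \<le> 2 * M * ln 3" .
  have "\<bar>\<psi> 2 * (ln 2 * 2 powr - s)\<bar> \<le> 1 * (ln 2 * 1)"
    unfolding abs_mult using small[of 2] abs_le_1[of 2] by (intro mult_mono) auto
  then have "\<bar>\<Sum>n<3. \<psi> n * (ln (real n) * real n powr - s)\<bar> \<le> ln 2"
    by (simp add: numeral_3_eq_3 numeral_2_eq_2)
  then show ?thesis using 1 by linarith
qed

text \<open>The series is the quotient -L'/L, whose numerator is bounded uniformly in s and whose
  denominator stays away from 0 near 1.\<close>

lemma mangoldt_series_bounded:
  "\<exists>C. \<forall>\<^sub>F s in at_right 1. \<bar>\<Sum>n. \<psi> n * (mangoldt n * real n powr - s)\<bar> \<le> C"
proof -
  obtain c where c: "c > 0" "\<forall>\<^sub>F s in at_right 1. \<bar>\<Sum>n. \<psi> n * real n powr - s\<bar> \<ge> c"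
    using L_eventually_bounded_below by blast
  define C where "C = ln 2 + 2 * M * ln (3::real)"
  have "\<forall>\<^sub>F s in at_right 1. \<bar>\<Sum>n. \<psi> n * (mangoldt n * real n powr - s)\<bar> \<le> C / c"
    using c(2) eventually_at_right_less
  proof eventually_elim
    case (elim s)
    let ?L = "\<Sum>n. \<psi> n * real n powr - s" and ?D = "\<Sum>n. \<psi> n * (mangoldt n * real n powr - s)"
    have "\<bar>?L\<bar> * \<bar>?D\<bar> \<le> C"
      using L_times_mangoldt_series[of s] ln_series_bounded[of s] elim(2)
      by (simp add: C_def flip: abs_mult)
    moreover have "c * \<bar>?D\<bar> \<le> \<bar>?L\<bar> * \<bar>?D\<bar>"
      using elim by (intro mult_right_mono) auto
    ultimately show ?case using c(1) by (simp add: field_simps)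
  qed
  then show ?thesis by blast
qed

end

section \<open>Primes with prescribed character values\<close>

lemma sum_powers_from_2_le:
  fixes x :: real
  assumes "0 \<le> x" "x \<le> 1 / 2"
  shows "(\<Sum>j=2..N. x ^ j) \<le> 2 * x\<^sup>2"
proof -
  have "(\<Sum>j=2..Suc N. x ^ j) \<le> 2 * x\<^sup>2 - 2 * x ^ Suc (Suc N)" for N
  proof (induction N)
    case (Suc N)
    have "x ^ Suc (Suc N) * (2 * x) \<le> x ^ Suc (Suc N) * 1"
      using assms by (intro mult_left_mono) auto
    then show ?case using Suc by (simp add: algebra_simps)
  qed (simp add: numeral_2_eq_2)
  then have "(\<Sum>j=2..N. x ^ j) \<le> 2 * x\<^sup>2 - 2 * x ^ Suc N" if "N > 0"
    using that by (metis Suc_pred')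
  then show ?thesis using assms by (cases "N = 0") (auto intro: order.trans)
qed

text \<open>Proper powers of a prime p contribute at most 2 * ln p / p^2. Thus only the primes
  themselves can make a von Mangoldt series diverge at s = 1.\<close>

lemma summable_mangoldt_nonprime:
  "summable (\<lambda>n. if prime n then 0 else mangoldt n / real n)"
proof (rule summableI_nonneg_bounded)
  define C where "C = (\<Sum>n. ln (real n) * real n powr - 2)"
  show "0 \<le> (if prime n then 0 else mangoldt n / real n :: real)" for n :: nat
    by (simp add: mangoldt_nonneg)
  fix N :: nat
  define P where "P = {p. prime p \<and> p < N}"
  define T where "T = {n. primepow n \<and> \<not> prime n \<and> n < N}"
  have "T \<subseteq> (\<lambda>(p, j). p ^ j) ` (P \<times> {2..N})"
  proof
    fix n assume n: "n \<in> T"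
    then obtain p j where pj: "prime p" "j > 0" "n = p ^ j"
      by (auto simp: T_def primepow_def)
    then have "j \<noteq> 1" using n by (auto simp: T_def)
    moreover have "j < p ^ j"
      using prime_ge_2_nat[OF pj(1)] by (intro less_le_trans[OF less_exp] power_mono) auto
    moreover have "p ^ 1 \<le> p ^ j"
      using prime_gt_0_nat[OF pj(1)] pj(2) by (intro power_increasing) auto
    ultimately have "p < N" "j \<in> {2..N}" using n pj by (auto simp: T_def)
    then show "n \<in> (\<lambda>(p, j). p ^ j) ` (P \<times> {2..N})"
      using pj by (auto simp: P_def)
  qed
  have fin: "finite P" by (simp add: P_def)
  have ln_nonneg: "ln (real n) \<ge> 0" for n by (cases "n = 0") auto
  have "(\<Sum>n<N. if prime n then 0 else mangoldt n / real n) = (\<Sum>n\<in>T. mangoldt n / real n)"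
    by (rule sum.mono_neutral_cong_right) (auto simp: T_def mangoldt_def)
  also have "\<dots> \<le> (\<Sum>n\<in>(\<lambda>(p, j). p ^ j) ` (P \<times> {2..N}). mangoldt n / real n)"
    using fin \<open>T \<subseteq> _\<close> by (intro sum_mono2) (auto simp: mangoldt_nonneg)
  also have "\<dots> \<le> (\<Sum>(p, j)\<in>P \<times> {2..N}. mangoldt (p ^ j) / real (p ^ j))"
    using fin by (intro order.trans[OF sum_image_le]) (auto simp: mangoldt_nonneg case_prod_beta)
  also have "\<dots> = (\<Sum>p\<in>P. ln (real p) * (\<Sum>j=2..N. (1 / real p) ^ j))"
    unfolding sum.cartesian_product[symmetric]
    by (auto simp: P_def sum_distrib_left power_divide intro!: sum.cong)
  also have "\<dots> \<le> (\<Sum>p\<in>P. ln (real p) * (2 * (1 / real p)\<^sup>2))"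
    by (intro sum_mono mult_left_mono sum_powers_from_2_le)
       (auto simp: P_def field_simps dest: prime_ge_2_nat prime_gt_0_nat intro!: ln_ge_zero)
  also have "\<dots> = 2 * (\<Sum>p\<in>P. ln (real p) * real p powr - 2)"
    by (auto simp: P_def sum_distrib_left powr_minus power_divide field_simps
        dest: prime_gt_0_nat intro!: sum.cong)
  also have "\<dots> \<le> 2 * C"
    unfolding C_def using fin
    by (intro mult_left_mono sum_le_suminf summable_ln_powr_minus) (use ln_nonneg in auto)
  finally show "(\<Sum>n<N. if prime n then 0 else mangoldt n / real n) \<le> 2 * C" .
qed

lemma zeta_series_unbounded:
  "\<forall>\<^sub>F s in at_right 1. (\<Sum>n. real n powr - s) \<ge> C"
proof -
  have "\<exists>N. (\<Sum>n<N. real n powr - 1) > C"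
  proof (rule ccontr)
    assume "\<nexists>N. (\<Sum>n<N. real n powr - 1) > C"
    then have "(\<Sum>n<N. real n powr - 1) \<le> C" for N
      by (auto simp: not_less)
    then have "summable (\<lambda>n. real n powr - 1)"
      by (intro summableI_nonneg_bounded) auto
    then have "(-1::real) < -1" by (subst (asm) summable_real_powr_iff)
    then show False by simp
  qed
  then obtain N where N: "(\<Sum>n<N. real n powr - 1) > C" ..
  have "((\<lambda>s. real n powr - s) \<longlongrightarrow> real n powr - 1) (at_right 1)" for n
    by (cases "n = 0") (simp, intro tendsto_intros, auto)
  then have "((\<lambda>s. \<Sum>n<N. real n powr - s) \<longlongrightarrow> (\<Sum>n<N. real n powr - 1)) (at_right 1)"
    by (intro tendsto_sum)
  then have "\<forall>\<^sub>F s in at_right 1. (\<Sum>n<N. real n powr - s) > C"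
    by (rule order_tendstoD) (fact N)
  then show ?thesis
    using eventually_at_right_less
  proof eventually_elim
    case (elim s)
    have "(\<Sum>n<N. real n powr - s) \<le> (\<Sum>n. real n powr - s)"
      using summable_powr_minus[of s] elim by (intro sum_le_suminf) auto
    then show ?case using elim by simp
  qed
qed

text \<open>The series is -zeta'/zeta. Replacing ln n by ln T costs at most T * ln T in total, from
  the terms n < T; once zeta is at least 2 * T this is at most half of ln T * zeta, and the quotient
  is at least ln T / 2.\<close>

lemma mangoldt_series_unbounded:
  "\<forall>\<^sub>F s in at_right 1. (\<Sum>n. mangoldt n * real n powr - s) \<ge> C"
proof -
  interpret real_character "\<lambda>_. 1" by unfold_locales auto
  obtain T :: nat where T: "real T > exp (2 * max C 0)" using reals_Archimedean2 by blast
  then have "T > 0" by (metis exp_gt_zero of_nat_0_less_iff order_less_trans)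
  have lnT: "ln (real T) \<ge> 2 * max C 0"
    using T \<open>T > 0\<close> by (simp add: ln_ge_iff less_imp_le)
  have "\<forall>\<^sub>F s in at_right 1. (\<Sum>n. real n powr - s) \<ge> 2 * real T"
    by (rule zeta_series_unbounded)
  then show ?thesis
    using eventually_at_right_less
  proof eventually_elim
    case (elim s)
    define Z where "Z = (\<Sum>n. real n powr - s)"
    have sum: "summable (\<lambda>n. real n powr - s)" "summable (\<lambda>n. ln (real n) * real n powr - s)"
      using elim summable_powr_minus summable_ln_powr_minus by auto
    have small: "real n powr - s \<le> 1" for n
      using elim powr_mono2'[of "- s" 1 "real n"] by (cases "n = 0") auto
    have "ln (real T) * real n powr - s \<le> ln (real n) * real n powr - s + (if n < T then ln (real T) else 0)" for n
    proof (cases "n < T")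
      case True
      have "ln (real T) * real n powr - s \<le> ln (real T) * 1"
        using small \<open>T > 0\<close> by (intro mult_left_mono) auto
      moreover have "ln (real n) * real n powr - s \<ge> 0"
        by (cases "n = 0") auto
      ultimately show ?thesis using True by simp
    next
      case False
      then show ?thesis using \<open>T > 0\<close> by (auto intro!: mult_right_mono)
    qed
    moreover have fin: "(\<lambda>n. if n < T then ln (real T) else 0) sums (\<Sum>n<T. ln (real T))"
      using sums_If_finite_set[of "{..<T}" "\<lambda>_. ln (real T)"] by simp
    ultimately have "(\<Sum>n. ln (real T) * real n powr - s)
        \<le> (\<Sum>n. ln (real n) * real n powr - s + (if n < T then ln (real T) else 0))"
      using sum by (intro suminf_le summable_mult summable_add sums_summable[OF fin]) auto
    also have "\<dots> = (\<Sum>n. ln (real n) * real n powr - s) + real T * ln (real T)"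
      using sum fin by (subst suminf_add[symmetric]) (auto simp: sums_iff)
    finally have "ln (real T) * Z \<le> (\<Sum>n. ln (real n) * real n powr - s) + real T * ln (real T)"
      using sum by (simp add: Z_def suminf_mult)
    then have "ln (real T) * Z \<le> Z * (\<Sum>n. mangoldt n * real n powr - s) + real T * ln (real T)"
      using L_times_mangoldt_series[of s] elim by (simp add: Z_def)
    moreover have "real T * ln (real T) \<le> Z / 2 * ln (real T)"
      using elim \<open>T > 0\<close> by (intro mult_right_mono) (auto simp: Z_def)
    ultimately have "Z * (ln (real T) / 2) \<le> Z * (\<Sum>n. mangoldt n * real n powr - s)"
      by (simp add: field_simps)
    moreover have "Z > 0" using elim \<open>T > 0\<close> by (simp add: Z_def)
    ultimately have "ln (real T) / 2 \<le> (\<Sum>n. mangoldt n * real n powr - s)" by simp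
    then show ?case using lnT by linarith
  qed
qed

lemma real_character_prod:
  assumes "finite A" "\<And>i. i \<in> A \<Longrightarrow> real_character (\<psi> i)"
  shows "real_character (\<lambda>n. \<Prod>i\<in>A. \<psi> i n)"
  using assms
proof (induction A rule: finite_induct)
  case empty
  show ?case by unfold_locales auto
next
  case (insert i A)
  interpret i: real_character "\<psi> i" using insert by simp
  interpret A: real_character "\<lambda>n. \<Prod>i\<in>A. \<psi> i n" using insert by simp
  show ?case
  proof
    show "(\<Prod>i\<in>insert i A. \<psi> i n) \<in> {-1, 0, 1}" for n
      using i.range[of n] A.range[of n] insert by auto
  qed (use insert i.mult A.mult i.one A.one in auto)
qed

text \<open>Multiplication by \<open>u\<close> permutes the residues modulo \<open>M\<close>, so the
  sum over a period equals its own negative.\<close>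

lemma nonprincipal_real_characterI:
  assumes "real_character \<psi>" and period: "\<And>n. \<psi> (n + M) = \<psi> n" and "M > 0"
    and u: "coprime u M" "\<psi> u = -1"
  shows "nonprincipal_real_character \<psi> M"
proof -
  interpret real_character \<psi> by fact
  have "\<psi> (n + k * M) = \<psi> n" for n k
  proof (induction k)
    case (Suc k)
    then show ?case using period[of "n + k * M"] by (simp add: ac_simps)
  qed simp
  then have mod: "\<psi> (n mod M) = \<psi> n" for n
    by (metis mod_div_mult_eq)
  have inj: "inj_on (\<lambda>n. u * n mod M) {..<M}"
  proof (rule inj_onI)
    fix x y assume xy: "x \<in> {..<M}" "y \<in> {..<M}" "u * x mod M = u * y mod M"
    then have "[x = y] (mod M)"
      using u(1) by (simp add: cong_def[symmetric] cong_mult_lcancel_nat)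
    then show "x = y" using xy by (simp add: cong_def)
  qed
  moreover have "(\<lambda>n. u * n mod M) ` {..<M} \<subseteq> {..<M}"
    using \<open>M > 0\<close> by auto
  ultimately have "(\<lambda>n. u * n mod M) ` {..<M} = {..<M}"
    by (simp add: endo_inj_surj)
  then have "(\<Sum>n<M. \<psi> n) = (\<Sum>n\<in>(\<lambda>n. u * n mod M) ` {..<M}. \<psi> n)" by simp
  also have "\<dots> = (\<Sum>n<M. \<psi> (u * n))"
    by (subst sum.reindex[OF inj]) (simp add: mod)
  also have "\<dots> = - (\<Sum>n<M. \<psi> n)"
    by (simp add: mult u(2) sum_negf)
  finally show ?thesis
    using period \<open>M > 0\<close> by unfold_locales auto
qed

text \<open>The weight \<open>W\<close> vanishes at every prime coprime to \<open>M\<close> with a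
  wrong character value. By \<open>indep\<close>, the product of the characters over any nonempty
  \<open>A\<close> is nonprincipal, so in the expansion of \<open>W\<close> only the term of the
  empty set is unbounded as s tends to 1. If the required primes were finite in number, the weighted
  sum would stay bounded.\<close>

theorem infinite_primes_with_character_values:
  fixes \<psi> :: "'i \<Rightarrow> nat \<Rightarrow> real" and \<epsilon> :: "'i \<Rightarrow> real"
  assumes "finite I" and char: "\<And>i. i \<in> I \<Longrightarrow> real_character (\<psi> i)"
    and period: "\<And>i n. i \<in> I \<Longrightarrow> \<psi> i (n + M) = \<psi> i n" and "M > 0"
    and nz: "\<And>i n. i \<in> I \<Longrightarrow> coprime n M \<Longrightarrow> \<psi> i n \<noteq> 0"
    and indep: "\<And>A. A \<subseteq> I \<Longrightarrow> A \<noteq> {} \<Longrightarrow> \<exists>u. coprime u M \<and> (\<Prod>i\<in>A. \<psi> i u) = -1"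
    and sgn: "\<And>i. i \<in> I \<Longrightarrow> \<epsilon> i \<in> {-1, 1}"
  shows "infinite {p. prime p \<and> (\<forall>i\<in>I. \<psi> i p = \<epsilon> i)}"
proof
  assume fin: "finite {p. prime p \<and> (\<forall>i\<in>I. \<psi> i p = \<epsilon> i)}"
  \<comment> \<open>Divisors of \<open>M\<close> join the exceptional set because a character may be
    0 there, and then its factor in \<open>W\<close> is 1 instead of 0.\<close>
  define F where "F = {p. prime p \<and> (\<forall>i\<in>I. \<psi> i p = \<epsilon> i)} \<union> {p. p dvd M}"
  have "finite F" using fin \<open>M > 0\<close> by (simp add: F_def)
  define D where "D A s = (\<Sum>n. (\<Prod>i\<in>A. \<psi> i n) * (mangoldt n * real n powr - s))" for A s
  define W where "W n = (\<Prod>i\<in>I. \<epsilon> i * \<psi> i n + 1)" for n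
  have prod_char: "real_character (\<lambda>n. \<Prod>i\<in>A. \<psi> i n)" if "A \<subseteq> I" for A
    by (rule real_character_prod[OF finite_subset[OF that \<open>finite I\<close>] char]) (use that in blast)
  have factor: "0 \<le> \<epsilon> i * \<psi> i n + 1 \<and> \<epsilon> i * \<psi> i n + 1 \<le> 2" if "i \<in> I" for i n
    using real_character.range[OF char[OF that], of n] sgn[OF that] by auto
  have W_nonneg: "W n \<ge> 0" for n
    unfolding W_def using factor by (intro prod_nonneg) auto
  have W_le: "W n \<le> 2 ^ card I" for n
    unfolding W_def using prod_mono[of I "\<lambda>i. \<epsilon> i * \<psi> i n + 1" "\<lambda>_. 2"] factor by simp
  have W_zero: "W p = 0" if p: "prime p" "p \<notin> F" for p
  proof -
    obtain i where i: "i \<in> I" "\<psi> i p \<noteq> \<epsilon> i" using p by (auto simp: F_def)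
    moreover have "coprime p M" using p by (simp add: F_def prime_imp_coprime)
    ultimately have "\<psi> i p = - \<epsilon> i"
      using nz[of i p] sgn[of i] real_character.range[OF char[OF i(1)], of p] by auto
    then have "\<epsilon> i * \<psi> i p + 1 = 0" using sgn[OF i(1)] by auto
    then show ?thesis unfolding W_def using i(1) \<open>finite I\<close> by (intro prod_zero) auto
  qed
  \<comment> \<open>A majorant independent of s: \<open>W\<close> can be nonzero only on the finite
    set \<open>F\<close> and at nonprimes, and both contribute a finite sum of
    \<open>mangoldt\<close> n / n.\<close>
  define v where "v n = (if n \<in> F then mangoldt n / real n else 0)
    + (if prime n then 0 else mangoldt n / real n)" for n :: nat
  have v: "summable v"
    unfolding v_def using \<open>finite F\<close>
    by (intro summable_add summable_mangoldt_nonprime sums_summable[OF sums_If_finite_set])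
  have le_v: "W n * (mangoldt n * real n powr - s) \<le> 2 ^ card I * v n" if "s > 1" for n s
  proof (cases "prime n \<and> n \<notin> F")
    case True
    then show ?thesis using W_zero[of n] by (simp add: v_def mangoldt_nonneg)
  next
    case False
    have "mangoldt n * real n powr - s \<le> mangoldt n * real n powr - 1"
      using that by (cases "n = 0") (simp, intro mult_left_mono powr_mono, auto simp: mangoldt_nonneg)
    also have "\<dots> = mangoldt n / real n"
      by (cases "n = 0") (auto simp: powr_minus_divide)
    also have "\<dots> \<le> v n"
      using False by (auto simp: v_def mangoldt_nonneg)
    finally show ?thesis
      using W_le by (intro mult_mono) (auto simp: mangoldt_nonneg)
  qed
  have expand: "(\<Sum>n. W n * (mangoldt n * real n powr - s)) = (\<Sum>A\<in>Pow I. (\<Prod>i\<in>A. \<epsilon> i) * D A s)"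
    and U_le: "(\<Sum>n. W n * (mangoldt n * real n powr - s)) \<le> 2 ^ card I * (\<Sum>n. v n)"
    if s: "s > 1" for s
  proof -
    have sums_A: "(\<lambda>n. (\<Prod>i\<in>A. \<psi> i n) * (mangoldt n * real n powr - s)) sums D A s" if "A \<subseteq> I" for A
    proof -
      interpret real_character "\<lambda>n. \<Prod>i\<in>A. \<psi> i n"
        using that by (rule prod_char)
      have "summable (\<lambda>n. \<bar>mangoldt n * real n powr - s\<bar>)"
        using summable_mangoldt_powr_minus[OF s] by (simp add: abs_mult mangoldt_nonneg)
      from summable_rabs_cancel[OF summable_abs_mult[OF this]] show ?thesis
        unfolding D_def by (rule summable_sums)
    qed
    have W_eq: "W n * t = (\<Sum>A\<in>Pow I. (\<Prod>i\<in>A. \<epsilon> i) * ((\<Prod>i\<in>A. \<psi> i n) * t))" for n t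
      unfolding W_def using \<open>finite I\<close>
      by (simp add: prod_add prod.distrib sum_distrib_right mult.assoc)
    have "(\<lambda>n. W n * (mangoldt n * real n powr - s)) sums (\<Sum>A\<in>Pow I. (\<Prod>i\<in>A. \<epsilon> i) * D A s)"
      unfolding W_eq by (intro sums_sum sums_mult sums_A) auto
    then show "(\<Sum>n. W n * (mangoldt n * real n powr - s)) = (\<Sum>A\<in>Pow I. (\<Prod>i\<in>A. \<epsilon> i) * D A s)"
      and "(\<Sum>n. W n * (mangoldt n * real n powr - s)) \<le> 2 ^ card I * (\<Sum>n. v n)"
      using suminf_le[OF le_v[OF s] _ summable_mult[OF v]] v
      by (auto simp: sums_iff suminf_mult)
  qed
  have "\<exists>C. \<forall>\<^sub>F s in at_right 1. \<bar>D A s\<bar> \<le> C" if A: "A \<subseteq> I" "A \<noteq> {}" for A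
  proof -
    obtain u where u: "coprime u M" "(\<Prod>i\<in>A. \<psi> i u) = -1" using indep[OF A] by blast
    have "real_character (\<lambda>n. \<Prod>i\<in>A. \<psi> i n)"
      using A(1) by (rule prod_char)
    moreover have "(\<Prod>i\<in>A. \<psi> i (n + M)) = (\<Prod>i\<in>A. \<psi> i n)" for n
      using A period by (intro prod.cong) auto
    ultimately interpret nonprincipal_real_character "\<lambda>n. \<Prod>i\<in>A. \<psi> i n" M
      using u \<open>M > 0\<close> by (intro nonprincipal_real_characterI)
    show ?thesis unfolding D_def by (rule mangoldt_series_bounded)
  qed
  then obtain C where C: "\<And>A. A \<subseteq> I \<Longrightarrow> A \<noteq> {} \<Longrightarrow> \<forall>\<^sub>F s in at_right 1. \<bar>D A s\<bar> \<le> C A"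
    by metis
  define B where "B = 2 ^ card I * (\<Sum>n. v n) + (\<Sum>A\<in>Pow I - {{}}. C A)"
  have "\<forall>\<^sub>F s in at_right 1. \<forall>A\<in>Pow I - {{}}. \<bar>D A s\<bar> \<le> C A"
    using \<open>finite I\<close> C by (intro eventually_ball_finite) auto
  moreover have "\<forall>\<^sub>F s in at_right 1. D {} s \<ge> B + 1"
    using mangoldt_series_unbounded by (simp add: D_def)
  ultimately have "\<forall>\<^sub>F s in at_right (1::real). False"
    using eventually_at_right_less
  proof eventually_elim
    case (elim s)
    have "D {} s + (\<Sum>A\<in>Pow I - {{}}. (\<Prod>i\<in>A. \<epsilon> i) * D A s) = (\<Sum>A\<in>Pow I. (\<Prod>i\<in>A. \<epsilon> i) * D A s)"
      using \<open>finite I\<close> by (subst sum.remove[of _ "{}"]) auto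
    also have "\<dots> \<le> 2 ^ card I * (\<Sum>n. v n)"
      using expand U_le elim by metis
    finally have "D {} s \<le> 2 ^ card I * (\<Sum>n. v n) - (\<Sum>A\<in>Pow I - {{}}. (\<Prod>i\<in>A. \<epsilon> i) * D A s)" by simp
    moreover have "- (\<Sum>A\<in>Pow I - {{}}. (\<Prod>i\<in>A. \<epsilon> i) * D A s) \<le> (\<Sum>A\<in>Pow I - {{}}. C A)"
      unfolding sum_negf[symmetric]
    proof (rule sum_mono)
      fix A assume A: "A \<in> Pow I - {{}}"
      have "\<bar>\<epsilon> i\<bar> = 1" if "i \<in> A" for i
      proof -
        have "i \<in> I" using A that by auto
        then show ?thesis using sgn[of i] by auto
      qed
      then have "\<bar>\<Prod>i\<in>A. \<epsilon> i\<bar> = 1"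
        unfolding abs_prod by (intro prod.neutral) auto
      then have "\<bar>(\<Prod>i\<in>A. \<epsilon> i) * D A s\<bar> = \<bar>D A s\<bar>" by (simp add: abs_mult)
      moreover have "\<bar>D A s\<bar> \<le> C A" using elim(1) A by blast
      ultimately show "- ((\<Prod>i\<in>A. \<epsilon> i) * D A s) \<le> C A" by linarith
    qed
    moreover have "D {} s \<ge> B + 1" by (rule elim(2))
    ultimately show ?case unfolding B_def by linarith
  qed
  then show False by (simp add: trivial_limit_at_right_real)
qed

section \<open>Legendre symbols and the characters modulo 4 and 8\<close>

lemma Legendre_cong: "[a = b] (mod p) \<Longrightarrow> Legendre a p = Legendre b p"
proof -
  assume ab: "[a = b] (mod p)"
  have "[a = 0] (mod p) \<longleftrightarrow> [b = 0] (mod p)" "QuadRes p a \<longleftrightarrow> QuadRes p b"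
    unfolding QuadRes_def using ab cong_sym cong_trans by blast+
  then show ?thesis by (simp add: Legendre_def)
qed

lemma Legendre_values: "Legendre a p \<in> {-1, 0, 1}"
  by (auto simp: Legendre_def)

lemma cong_imp_eq_small:
  fixes a b :: int
  assumes "[a = b] (mod int p)" "\<bar>a - b\<bar> < int p"
  shows "a = b"
proof (rule ccontr)
  assume "a \<noteq> b"
  moreover have "int p dvd a - b" using assms(1) by (simp add: cong_iff_dvd_diff)
  ultimately have "\<bar>int p\<bar> \<le> \<bar>a - b\<bar>" by (intro dvd_imp_le_int) auto
  then show False using assms(2) by simp
qed

lemma Legendre_mult:
  assumes "prime p" "p > 2"
  shows "Legendre (a * b) (int p) = Legendre a (int p) * Legendre b (int p)"
proof -
  have "[Legendre a (int p) * Legendre b (int p) = (a * b) ^ ((p - 1) div 2)] (mod int p)"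
    unfolding power_mult_distrib by (intro cong_mult euler_criterion assms)
  then have "[Legendre (a * b) (int p) = Legendre a (int p) * Legendre b (int p)] (mod int p)"
    using cong_trans[OF euler_criterion[OF assms]] cong_sym by blast
  moreover have "\<bar>Legendre (a * b) (int p) - Legendre a (int p) * Legendre b (int p)\<bar> < int p"
    using Legendre_values[of "a * b" "int p"] Legendre_values[of a "int p"]
      Legendre_values[of b "int p"] assms(2) by auto
  ultimately show ?thesis by (rule cong_imp_eq_small)
qed

lemma Legendre_one: "p > 1 \<Longrightarrow> Legendre 1 (int p) = 1"
  unfolding Legendre_def QuadRes_def cong_0_iff
  by (auto intro: exI[of _ 1])

lemma Legendre_minus_one:
  assumes "prime p" "p > 2"
  shows "Legendre (-1) (int p) = (if p mod 4 = 1 then 1 else -1)"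
proof -
  have "odd p" using assms prime_odd_nat by blast
  have "[Legendre (-1) (int p) = (-1) ^ ((p - 1) div 2)] (mod int p)"
    by (rule euler_criterion[OF assms])
  moreover have "\<bar>Legendre (-1) (int p) - (-1) ^ ((p - 1) div 2)\<bar> < int p"
    using Legendre_values[of "-1" "int p"] assms(2) by (cases "even ((p - 1) div 2)") auto
  ultimately have "Legendre (-1) (int p) = (-1) ^ ((p - 1) div 2)"
    by (rule cong_imp_eq_small)
  moreover have "even ((p - 1) div 2) \<longleftrightarrow> p mod 4 = 1"
    using \<open>odd p\<close> by presburger
  ultimately show ?thesis by (cases "even ((p - 1) div 2)") auto
qed

text \<open>Gauss's lemma with p = 2 * h + 1: the doubles of 1, ..., h are already reduced modulo p,
  and those exceeding h come from the x above h div 2, which is h - h div 2 values.\<close>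

lemma Legendre_two:
  assumes "prime p" "p > 2"
  shows "Legendre 2 (int p) = (if p mod 8 \<in> {1, 7} then 1 else -1)"
proof -
  interpret GAUSS p 2
    using assms by unfold_locales (auto simp: cong_0_iff zdvd_not_zless)
  define h where "h = (int p - 1) div 2"
  have p: "int p = 2 * h + 1" using p_eq2 by (simp add: h_def)
  have "h > 0" using assms(2) p by linarith
  have "C = (\<lambda>x. x * 2) ` {0<..h}"
    unfolding C_def B_def A_def h_def[symmetric] image_image
    by (rule image_cong) (use p in auto)
  then have "E = (\<lambda>x. x * 2) ` {h div 2<..h}"
    using \<open>h > 0\<close> by (auto simp: E_def h_def[symmetric])
  then have "card E = nat (h - h div 2)"
    by (simp add: card_image inj_on_def)
  moreover have "even (nat (h - h div 2)) \<longleftrightarrow> p mod 8 \<in> {1, 7}"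
  proof -
    have "even (h - h div 2) \<longleftrightarrow> (2 * h + 1) mod 8 = 1 \<or> (2 * h + 1) mod 8 = 7"
      by presburger
    moreover have "int (p mod 8) = (2 * h + 1) mod 8" by (simp add: zmod_int p)
    ultimately show ?thesis using \<open>h > 0\<close> by (simp add: even_nat_iff) linarith
  qed
  ultimately show ?thesis
    using gauss_lemma by (cases "even (card E)") auto
qed

lemma Legendre_swap:
  assumes "prime p" "p mod 4 = 1" "prime q" "q > 2" "p \<noteq> q"
  shows "Legendre (int q) (int p) = Legendre (int p) (int q)"
proof -
  have "p > 2" using assms(1,2) prime_ge_2_nat[of p] by (cases "p = 2") auto
  have "even ((p - 1) div 2)" using assms(2) by presburger
  then have "Legendre (int p) (int q) * Legendre (int q) (int p) = 1"
    using Quadratic_Reciprocity[of p q] assms \<open>p > 2\<close> by simp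
  then show ?thesis
    using Legendre_values[of "int p" "int q"] Legendre_values[of "int q" "int p"] by auto
qed

definition legendre_char :: "nat \<Rightarrow> nat \<Rightarrow> real" where
  "legendre_char p n = of_int (Legendre (int n) (int p))"

text \<open>The Jacobi symbol (-1/n) on odd n, extended by 0.\<close>

definition char4 :: "nat \<Rightarrow> real" where
  "char4 n = (if n mod 4 = 1 then 1 else if n mod 4 = 3 then -1 else 0)"

text \<open>The Jacobi symbol (2/n) on odd n, extended by 0.\<close>

definition char8 :: "nat \<Rightarrow> real" where
  "char8 n = (if n mod 8 \<in> {1, 7} then 1 else if n mod 8 \<in> {3, 5} then -1 else 0)"

lemma real_character_legendre:
  assumes "prime p" "p > 2"
  shows "real_character (legendre_char p)"
proof
  show "legendre_char p n \<in> {-1, 0, 1}" for n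
    using Legendre_values[of "int n" "int p"] by (auto simp: legendre_char_def)
qed (use assms Legendre_one[of p] in \<open>auto simp: legendre_char_def Legendre_mult\<close>)

lemma real_character_char4: "real_character char4"
proof
  fix a b :: nat
  have "\<forall>x\<in>{..<4}. \<forall>y\<in>{..<4}. char4 (x * y) = char4 x * char4 y"
    by (simp add: char4_def lessThan_nat_numeral lessThan_Suc)
  then have "char4 ((a mod 4) * (b mod 4)) = char4 (a mod 4) * char4 (b mod 4)"
    by simp
  moreover have "char4 (n mod 4) = char4 n" for n
    by (simp add: char4_def)
  moreover have "char4 ((a mod 4) * (b mod 4)) = char4 (a * b)"
    by (simp only: char4_def mod_mult_eq)
  ultimately show "char4 (a * b) = char4 a * char4 b" by simp
qed (auto simp: char4_def)

lemma real_character_char8: "real_character char8"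
proof
  fix a b :: nat
  have "\<forall>x\<in>{..<8}. \<forall>y\<in>{..<8}. char8 (x * y) = char8 x * char8 y"
    by (simp add: char8_def lessThan_nat_numeral lessThan_Suc)
  then have "char8 ((a mod 8) * (b mod 8)) = char8 (a mod 8) * char8 (b mod 8)"
    by simp
  moreover have "char8 (n mod 8) = char8 n" for n
    by (simp add: char8_def)
  moreover have "char8 ((a mod 8) * (b mod 8)) = char8 (a * b)"
    by (simp only: char8_def mod_mult_eq)
  ultimately show "char8 (a * b) = char8 a * char8 b" by simp
qed (auto simp: char8_def)

lemma real_character_mult:
  assumes "real_character \<psi>" "real_character \<phi>"
  shows "real_character (\<lambda>n. \<psi> n * \<phi> n)"
proof -
  interpret a: real_character \<psi> by fact
  interpret b: real_character \<phi> by fact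
  show ?thesis
  proof
    show "\<psi> n * \<phi> n \<in> {-1, 0, 1}" for n
      using a.range[of n] b.range[of n] by auto
  qed (auto simp: a.mult b.mult a.one[simplified] b.one[simplified])
qed

lemma real_character_eqI:
  assumes "real_character \<psi>" "real_character \<phi>" "n > 0"
    and "\<And>q. prime q \<Longrightarrow> q dvd n \<Longrightarrow> \<psi> q = \<phi> q"
  shows "\<psi> n = \<phi> n"
  using assms(3,4)
proof (induction n rule: less_induct)
  case (less n)
  interpret a: real_character \<psi> by fact
  interpret b: real_character \<phi> by fact
  show ?case
  proof (cases "n = 1")
    case False
    then obtain q k where q: "prime q" "n = q * k"
      using prime_factor_nat by (metis dvdE)
    then have "k < n" "k > 0" using less.prems prime_gt_1_nat[of q] by auto
    then have "\<psi> k = \<phi> k" using less q by auto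
    then show ?thesis using less.prems(2)[of q] q by (simp add: a.mult b.mult)
  qed (use a.one b.one in simp)
qed

lemma legendre_char_cong: "[m = n] (mod p) \<Longrightarrow> legendre_char p m = legendre_char p n"
  unfolding legendre_char_def by (simp add: Legendre_cong cong_int_iff)

lemma legendre_char_nonzero: "prime p \<Longrightarrow> coprime n p \<Longrightarrow> legendre_char p n \<noteq> 0"
  using not_prime_unit[of p]
  by (auto simp: legendre_char_def Legendre_def cong_0_iff coprime_absorb_left coprime_absorb_right split: if_splits)

text \<open>Otherwise squaring would be onto, hence injective, on the nonzero residues; but 1 and p
  - 1 have the same square.\<close>

lemma ex_nonresidue:
  assumes "prime p" "p > 2"
  shows "\<exists>n. coprime n p \<and> legendre_char p n = -1"
proof (rule ccontr)
  assume no: "\<nexists>n. coprime n p \<and> legendre_char p n = -1"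
  define f where "f y = y\<^sup>2 mod int p" for y
  have "{1..<int p} \<subseteq> f ` {1..<int p}"
  proof
    fix a assume a: "a \<in> {1..<int p}"
    have "\<not> p dvd nat a" using a by (auto dest: dvd_imp_le)
    then have "coprime (nat a) p"
      using prime_imp_coprime[OF assms(1), of "nat a"] coprime_commute by blast
    then have "legendre_char p (nat a) = 1"
      using no real_character.range[OF real_character_legendre[OF assms], of "nat a"]
        legendre_char_nonzero[OF assms(1)] by auto
    then have "QuadRes (int p) a"
      using a by (auto simp: legendre_char_def Legendre_def split: if_splits)
    then obtain y where y: "[y\<^sup>2 = a] (mod int p)" unfolding QuadRes_def by blast
    then have "f (y mod int p) = a"
      using a by (simp add: f_def cong_def power_mod)
    moreover have "y mod int p \<noteq> 0"
      using calculation a by (auto simp: f_def)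
    moreover have "0 \<le> y mod int p" "y mod int p < int p"
      using assms(2) by simp_all
    ultimately have "y mod int p \<in> {1..<int p}" "f (y mod int p) = a"
      by simp_all
    then show "a \<in> f ` {1..<int p}" by force
  qed
  then have "inj_on f {1..<int p}"
    by (meson finite_atLeastLessThan_int finite_surj_inj)
  moreover have "f 1 = f (int p - 1)"
  proof -
    have "(int p - 1)\<^sup>2 = 1 + int p * (int p - 2)"
      by (simp add: power2_eq_square algebra_simps)
    then show ?thesis unfolding f_def by simp
  qed
  ultimately have "1 = int p - 1"
    using assms(2) by (auto dest!: inj_onD)
  then show False using assms(2) by simp
qed

text \<open>Independence comes from the Chinese remainder theorem: if \<open>A\<close> contains a
  prime q of \<open>S\<close>, take u to be a nonresidue modulo q and 1 modulo the rest of
  \<open>M\<close>; otherwise choose u modulo 8 alone.\<close>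

lemma ex_prime_with_legendre_values:
  fixes \<epsilon> :: "nat \<Rightarrow> real"
  assumes "finite S" and S: "\<And>q. q \<in> S \<Longrightarrow> prime q \<and> q > 2"
    and sgn: "\<And>q. q \<in> S \<Longrightarrow> \<epsilon> q \<in> {-1, 1}" and r: "r \<in> {1, 5}"
  obtains p where "prime p" "p mod 8 = r" "\<And>q. q \<in> S \<Longrightarrow> legendre_char q p = \<epsilon> q"
proof -
  text \<open>The indices 0 and 2 are not odd primes and hence free to stand for the characters modulo 8.\<close>
  define \<psi> where "\<psi> i = (if i = 0 then char4 else if i = 2 then char8 else legendre_char i)" for i :: nat
  define I where "I = {0, 2} \<union> S"
  define M where "M = 8 * \<Prod>S"
  \<comment> \<open>The values \<open>char4\<close> = 1 and \<open>char8\<close> = 1 or -1 select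
    exactly the residues 1 or 5 modulo 8.\<close>
  define \<delta> where "\<delta> i = (if i = 0 then 1 else if i = 2 then (if r = 1 then 1 else -1) else \<epsilon> i)" for i
  have S': "0 \<notin> S" "2 \<notin> S" using S by force+
  have \<psi>_S: "\<psi> q = legendre_char q" if "q \<in> S" for q
    using that S' by (auto simp: \<psi>_def)
  have char: "real_character (\<psi> i)" if "i \<in> I" for i
    using that S by (auto simp: I_def \<psi>_def real_character_char4 real_character_char8 real_character_legendre)
  have "\<Prod>S > 0" using S prime_gt_0_nat by (intro prod_pos) blast
  then have "M > 0" by (simp add: M_def)
  have dvd_M: "q dvd M" if "q \<in> S" for q
    unfolding M_def using dvd_prodI[OF \<open>finite S\<close> that, of "\<lambda>x. x"] by (intro dvd_mult) simp
  have cong8: "\<psi> i m = \<psi> i n" if "i \<in> {0, 2}" "[m = n] (mod 8)" for i m n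
  proof -
    have "m mod 8 = n mod 8" using that(2) by (simp add: cong_def)
    moreover from this have "m mod 4 = n mod 4"
      using mod_mod_cancel[of 4 8 m] mod_mod_cancel[of 4 8 n] by simp
    ultimately show ?thesis using that(1) by (auto simp: \<psi>_def char4_def char8_def)
  qed
  have cong_S: "\<psi> q m = \<psi> q n" if "q \<in> S" "[m = n] (mod q)" for q m n
    using that by (simp add: \<psi>_S legendre_char_cong)
  have period: "\<psi> i (n + M) = \<psi> i n" if "i \<in> I" for i n
  proof (cases "i \<in> S")
    case True
    then show ?thesis using dvd_M by (intro cong_S) (auto simp: cong_def mod_add_right_eq[symmetric])
  next
    case False
    then show ?thesis using that
      by (intro cong8) (auto simp: I_def M_def cong_def)
  qed
  have nz: "\<psi> i n \<noteq> 0" if "i \<in> I" "coprime n M" for i n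
  proof (cases "i \<in> S")
    case True
    have "coprime n i"
      using that(2) dvd_M[OF True] coprime_divisors[of n n i M] by auto
    then show ?thesis using True S by (simp add: \<psi>_S legendre_char_nonzero)
  next
    case False
    have "odd n"
    proof
      assume "even n"
      moreover have "even M" by (simp add: M_def)
      ultimately show False using coprime_common_divisor[OF that(2), of 2] by simp
    qed
    then have "n mod 8 \<in> {1, 3, 5, 7}" "n mod 4 \<in> {1, 3}" by auto presburger+
    then show ?thesis using that False by (auto simp: I_def \<psi>_def char4_def char8_def)
  qed
  have one: "\<psi> i 1 = 1" if "i \<in> I" for i
    using char[OF that] by (rule real_character.one)
  have odd_prod: "coprime 8 (\<Prod>T)" if "T \<subseteq> S" for T
  proof (intro prod_coprime_right)
    fix q assume "q \<in> T"
    then have "coprime 2 q"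
      using that S[of q] by (intro primes_coprime) auto
    then show "coprime 8 q" using coprime_power_left_iff[of 2 3 q] by simp
  qed
  have indep: "\<exists>u. coprime u M \<and> (\<Prod>i\<in>A. \<psi> i u) = -1" if A: "A \<subseteq> I" "A \<noteq> {}" for A
  proof (cases "A \<inter> S = {}")
    case True
    \<comment> \<open>Both characters are -1 at 3, so their product is 1 there; at 5 only
      \<open>char8\<close> is -1.\<close>
    define v :: nat where "v = (if A = {0, 2} then 5 else 3)"
    have "A \<subseteq> {0, 2}" using True A by (auto simp: I_def)
    then have "A = {0} \<or> A = {2} \<or> A = {0, 2}" using A by auto
    then have v: "(\<Prod>i\<in>A. \<psi> i v) = -1"
      by (auto simp: v_def \<psi>_def char4_def char8_def doubleton_eq_iff)
    obtain u where u: "[u = v] (mod 8)" "[u = 1] (mod \<Prod>S)"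
      using binary_chinese_remainder_nat[OF odd_prod[OF order.refl]] by blast
    have "coprime u 8"
    proof (rule cong_imp_coprime[OF cong_sym[OF u(1)]])
      have "coprime 3 (2 ^ 3 :: nat)" "coprime 5 (2 ^ 3 :: nat)"
        unfolding coprime_power_right_iff by auto
      then show "coprime v 8" by (simp add: v_def)
    qed
    moreover have "coprime u (\<Prod>S)"
      using cong_imp_coprime[OF cong_sym[OF u(2)]] by simp
    ultimately have "coprime u M" by (simp add: M_def)
    moreover have "(\<Prod>i\<in>A. \<psi> i u) = (\<Prod>i\<in>A. \<psi> i v)"
      using u(1) \<open>A \<subseteq> {0, 2}\<close> by (intro prod.cong) (auto intro: cong8)
    ultimately show ?thesis using v by auto
  next
    case False
    then obtain q where q: "q \<in> A" "q \<in> S" by auto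
    define m where "m = 8 * \<Prod>(S - {q})"
    have M_eq: "M = q * m"
      using \<open>finite S\<close> q(2) by (simp add: M_def m_def prod.remove)
    have "coprime q (\<Prod>(S - {q}))"
      using S q(2) by (intro prod_coprime_right) (auto simp: primes_coprime)
    moreover have "coprime q 8"
      using odd_prod[of "{q}"] q(2) by (simp add: coprime_commute)
    ultimately have "coprime q m" by (simp add: m_def)
    obtain v where v: "coprime v q" "legendre_char q v = -1"
      using ex_nonresidue S[OF q(2)] by blast
    obtain u where u: "[u = v] (mod q)" "[u = 1] (mod m)"
      using binary_chinese_remainder_nat[OF \<open>coprime q m\<close>] by blast
    have "coprime u q" using cong_imp_coprime[OF cong_sym[OF u(1)]] v(1) by simp
    moreover have "coprime u m" using cong_imp_coprime[OF cong_sym[OF u(2)]] by simp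
    ultimately have "coprime u M" by (simp add: M_eq)
    have "\<psi> i u = 1" if "i \<in> A - {q}" for i
    proof (cases "i \<in> S")
      case True
      then have "i dvd m"
        unfolding m_def using that dvd_prodI[of "S - {q}" i "\<lambda>x. x"] \<open>finite S\<close>
        by (intro dvd_mult) simp
      then show ?thesis
        using cong_S[OF True cong_dvd_modulus_nat[OF u(2)]] one[of i] A(1) that by auto
    next
      case False
      then have "i \<in> {0, 2}" using A(1) that by (auto simp: I_def)
      moreover have "[u = 1] (mod 8)"
        using u(2) by (rule cong_dvd_modulus_nat) (simp add: m_def)
      ultimately show ?thesis using cong8[of i u 1] one[of i] by (auto simp: I_def)
    qed
    then have "(\<Prod>i\<in>A - {q}. \<psi> i u) = 1" by (intro prod.neutral) auto
    moreover have "\<psi> q u = -1"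
      using cong_S[OF q(2) u(1)] v(2) by (simp add: \<psi>_S[OF q(2)])
    moreover have "finite A"
      using A(1) by (rule finite_subset) (simp add: I_def \<open>finite S\<close>)
    ultimately have "(\<Prod>i\<in>A. \<psi> i u) = -1"
      using q(1) by (simp add: prod.remove[of A q])
    then show ?thesis using \<open>coprime u M\<close> by blast
  qed
  have "infinite {p. prime p \<and> (\<forall>i\<in>I. \<psi> i p = \<delta> i)}"
  proof -
    have "finite I" using \<open>finite S\<close> by (simp add: I_def)
    moreover have "\<delta> i \<in> {-1, 1}" if "i \<in> I" for i
      using that sgn[of i] by (auto simp: I_def \<delta>_def)
    ultimately show ?thesis
      by (intro infinite_primes_with_character_values[OF _ char period \<open>M > 0\<close> nz indep])
  qed
  then have "{p. prime p \<and> (\<forall>i\<in>I. \<psi> i p = \<delta> i)} \<noteq> {}"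
    by (rule infinite_imp_nonempty)
  then obtain p where p: "prime p" "\<And>i. i \<in> I \<Longrightarrow> \<psi> i p = \<delta> i"
    by blast
  have "char4 p = 1" "char8 p = (if r = 1 then 1 else -1)"
    using p(2)[of 0] p(2)[of 2] by (auto simp: \<psi>_def \<delta>_def I_def)
  then have "p mod 4 = 1" "p mod 8 \<in> (if r = 1 then {1, 7} else {3, 5})"
    by (auto simp: char4_def char8_def split: if_splits)
  then have "p mod 8 = r" using r by (auto split: if_splits) presburger+
  moreover have "legendre_char q p = \<epsilon> q" if "q \<in> S" for q
    using p(2)[of q] that S' by (auto simp: \<psi>_S I_def \<delta>_def)
  ultimately show thesis using that p(1) by blast
qed

text \<open>Prime factors are added one at a time: by a Hensel step if the prime already divides the
  modulus, by Chinese remaindering otherwise.\<close>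

lemma square_root_mod_lift:
  fixes a :: int
  assumes "k > 0" "odd k" "\<And>q. prime q \<Longrightarrow> q dvd k \<Longrightarrow> Legendre a (int q) = 1"
  shows "\<exists>b. int k dvd b\<^sup>2 - a"
  using assms
proof (induction k rule: less_induct)
  case (less k)
  show ?case
  proof (cases "k = 1")
    case False
    then obtain q m where q: "prime q" "k = q * m"
      using prime_factor_nat by (metis dvdE)
    then have "m < k" "m > 0" using less.prems(1) prime_gt_1_nat[of q] by auto
    have "q \<noteq> 2" "odd m" using less.prems(2) q by auto
    have leg: "Legendre a (int q) = 1" using less.prems(3) q by simp
    then have na: "\<not> int q dvd a" and "QuadRes (int q) a"
      by (auto simp: Legendre_def cong_0_iff split: if_splits)
    obtain b where b: "int m dvd b\<^sup>2 - a"
      using less.IH[OF \<open>m < k\<close> \<open>m > 0\<close> \<open>odd m\<close>] less.prems(3) q by auto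
    show ?thesis
    proof (cases "q dvd m")
      case True
      have "\<not> int q dvd b"
      proof
        assume "int q dvd b"
        then have "int q dvd b\<^sup>2" by (simp add: power2_eq_square)
        moreover have "int q dvd b\<^sup>2 - a" using True b by (meson dvd_trans of_nat_dvd_iff)
        ultimately have "int q dvd b\<^sup>2 - (b\<^sup>2 - a)" by (rule dvd_diff)
        then show False using na by simp
      qed
      moreover have "\<not> int q dvd 2"
      proof
        assume "int q dvd 2"
        then have "int q \<le> 2" by (rule zdvd_imp_le) simp
        then show False using prime_ge_2_nat[OF q(1)] \<open>q \<noteq> 2\<close> by simp
      qed
      ultimately have "\<not> int q dvd 2 * b"
        using q(1) by (simp add: prime_dvd_mult_iff)
      then have "coprime (int q) (2 * b)"
        using q(1) by (intro prime_imp_coprime) auto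
      then have "coprime (2 * b) (int q)" by (simp only: coprime_commute)
      then obtain x where x: "[2 * b * x = 1] (mod int q)"
        using cong_solve_coprime_int by blast
      obtain t where t: "b\<^sup>2 - a = int m * t" using b by blast
      \<comment> \<open>This solves t + 2 * b * s = 0 modulo q; the quadratic term carries a further
        factor m, which q divides.\<close>
      define s where "s = - t * x"
      have "(b + int m * s)\<^sup>2 - a = (b\<^sup>2 - a) + int m * (2 * b * s + int m * s\<^sup>2)"
        by (simp add: power2_eq_square algebra_simps)
      also have "\<dots> = int m * (t * (1 - 2 * b * x) + int m * s\<^sup>2)"
        unfolding t by (simp add: s_def algebra_simps)
      finally have eq: "(b + int m * s)\<^sup>2 - a = int m * (t * (1 - 2 * b * x) + int m * s\<^sup>2)" .
      have "int q dvd 1 - 2 * b * x"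
        using cong_sym[OF x] by (simp add: cong_iff_dvd_diff)
      then have "int q dvd t * (1 - 2 * b * x) + int m * s\<^sup>2"
        using True by (intro dvd_add dvd_mult dvd_mult2) auto
      then have "int k dvd (b + int m * s)\<^sup>2 - a"
        unfolding eq q(2) by (simp add: mult.commute mult_dvd_mono)
      then show ?thesis by blast
    next
      case False
      obtain y where y: "[y\<^sup>2 = a] (mod int q)"
        using \<open>QuadRes (int q) a\<close> by (auto simp: QuadRes_def)
      have "coprime (int q) (int m)"
        using False q(1) by (simp add: prime_imp_coprime)
      then obtain z where z: "[z = y] (mod int q)" "[z = b] (mod int m)"
        using binary_chinese_remainder_int by blast
      have "[z\<^sup>2 = a] (mod int q)" using cong_trans[OF cong_pow[OF z(1)] y] .
      moreover have "[z\<^sup>2 = a] (mod int m)"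
        using cong_trans[OF cong_pow[OF z(2), of 2]] b by (simp add: cong_iff_dvd_diff)
      ultimately have "int k dvd z\<^sup>2 - a"
        using \<open>coprime (int q) (int m)\<close> q(2)
        by (simp add: cong_iff_dvd_diff divides_mult)
      then show ?thesis by blast
    qed
  qed simp
qed

section \<open>Ternary forms of determinant one\<close>

text \<open>A shift by k makes \<bar>2 * B'\<bar> \<le> A, and exchanging the variables lowers the
  first coefficient while C' < A. Once C' \<ge> A, the determinant satisfies 4 * (A * C' - B'^2)
  \<ge> 4 * A^2 - A^2.\<close>

lemma binary_form_reduction:
  fixes A B C :: int
  assumes "A > 0" "A * C - B\<^sup>2 > 0"
  obtains p q r s where "p * s - q * r = 1" "A * p\<^sup>2 + 2 * B * p * r + C * r\<^sup>2 > 0"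
    "3 * (A * p\<^sup>2 + 2 * B * p * r + C * r\<^sup>2)\<^sup>2 \<le> 4 * (A * C - B\<^sup>2)"
proof -
  have "\<exists>p q r s. p * s - q * r = 1 \<and> A * p\<^sup>2 + 2 * B * p * r + C * r\<^sup>2 > 0
    \<and> 3 * (A * p\<^sup>2 + 2 * B * p * r + C * r\<^sup>2)\<^sup>2 \<le> 4 * (A * C - B\<^sup>2)"
    using assms
  proof (induction "nat A" arbitrary: A B C rule: less_induct)
    case less
    \<comment> \<open>Adding A before the floor division rounds B / A to a nearest integer.\<close>
    define k where "k = - ((2 * B + A) div (2 * A))"
    define B' where "B' = B + k * A"
    define C' where "C' = A * k\<^sup>2 + 2 * B * k + C"
    have "(2 * B + A) mod (2 * A) = 2 * B' + A"
      by (simp add: B'_def k_def minus_div_mult_eq_mod[symmetric] algebra_simps)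
    then have "0 \<le> 2 * B' + A" "2 * B' + A < 2 * A"
      using less.prems(1) pos_mod_bound[of "2 * A" "2 * B + A"] pos_mod_sign[of "2 * A" "2 * B + A"] by auto
    then have absB: "\<bar>2 * B'\<bar> \<le> A" by linarith
    have disc: "A * C' - B'\<^sup>2 = A * C - B\<^sup>2"
      by (simp add: B'_def C'_def power2_eq_square algebra_simps)
    show ?case
    proof (cases "C' < A")
      case False
      have "(2 * B')\<^sup>2 \<le> A\<^sup>2" using power_mono[OF absB, of 2] by simp
      moreover have "A * A \<le> A * C'" using False less.prems(1) by (intro mult_left_mono) auto
      ultimately have "3 * A\<^sup>2 \<le> 4 * (A * C - B\<^sup>2)"
        unfolding disc[symmetric] by (simp add: power2_eq_square)
      then show ?thesis
        using less.prems(1) by (intro exI[of _ 1] exI[of _ 0]) auto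
    next
      case True
      have "A * C' > 0" using disc less.prems(2) zero_le_power2[of B'] by linarith
      then have "C' > 0" using less.prems(1) by (simp add: zero_less_mult_iff)
      \<comment> \<open>The exchange is made with one sign change, so that the transformation keeps
        determinant 1; this turns B' into -B'.\<close>
      have "C' * A - (- B')\<^sup>2 = A * C - B\<^sup>2" using disc by (simp add: mult.commute)
      with True \<open>C' > 0\<close> less.hyps[of C' A "- B'"] less.prems(2) obtain p q r s where
        *: "p * s - q * r = 1" "C' * p\<^sup>2 + 2 * (- B') * p * r + A * r\<^sup>2 > 0"
        "3 * (C' * p\<^sup>2 + 2 * (- B') * p * r + A * r\<^sup>2)\<^sup>2 \<le> 4 * (A * C - B\<^sup>2)"
        by auto
      have "C' * p\<^sup>2 + 2 * (- B') * p * r + A * r\<^sup>2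
          = A * (k * p - r)\<^sup>2 + 2 * B * (k * p - r) * p + C * p\<^sup>2"
        by (simp add: B'_def C'_def power2_eq_square algebra_simps)
      moreover have "(k * p - r) * q - (k * q - s) * p = 1"
        using *(1) by (simp add: algebra_simps)
      ultimately show ?thesis using *(2,3) by metis
    qed
  qed
  then show thesis using that by blast
qed

text \<open>The Gram matrix has rows (a, t, s), (t, b, r), (s, r, c): each of r, s, t sits opposite
  to a, b, c respectively.\<close>

definition ternary_form :: "int \<Rightarrow> int \<Rightarrow> int \<Rightarrow> int \<Rightarrow> int \<Rightarrow> int \<Rightarrow> int \<Rightarrow> int \<Rightarrow> int \<Rightarrow> int" where
  "ternary_form a b c r s t x y z = a * x\<^sup>2 + b * y\<^sup>2 + c * z\<^sup>2 + 2 * r * y * z + 2 * s * x * z + 2 * t * x * y"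

definition sum_of_three_linear_squares :: "(int \<Rightarrow> int \<Rightarrow> int \<Rightarrow> int) \<Rightarrow> bool" where
  "sum_of_three_linear_squares f \<longleftrightarrow> (\<exists>u1 v1 w1 u2 v2 w2 u3 v3 w3. \<forall>x y z.
    f x y z = (u1 * x + v1 * y + w1 * z)\<^sup>2 + (u2 * x + v2 * y + w2 * z)\<^sup>2 + (u3 * x + v3 * y + w3 * z)\<^sup>2)"

lemma sum_of_three_linear_squares_subst:
  assumes "sum_of_three_linear_squares g"
    and "\<And>x y z. f x y z = g (a1 * x + b1 * y + c1 * z) (a2 * x + b2 * y + c2 * z) (a3 * x + b3 * y + c3 * z)"
  shows "sum_of_three_linear_squares f"
proof -
  have lin: "u * (a1 * x + b1 * y + c1 * z) + v * (a2 * x + b2 * y + c2 * z) + w * (a3 * x + b3 * y + c3 * z)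
      = (u * a1 + v * a2 + w * a3) * x + (u * b1 + v * b2 + w * b3) * y + (u * c1 + v * c2 + w * c3) * z"
    for u v w x y z by (simp add: algebra_simps)
  from assms(1) obtain u1 v1 w1 u2 v2 w2 u3 v3 w3 where
    g: "\<And>x y z. g x y z = (u1 * x + v1 * y + w1 * z)\<^sup>2 + (u2 * x + v2 * y + w2 * z)\<^sup>2 + (u3 * x + v3 * y + w3 * z)\<^sup>2"
    unfolding sum_of_three_linear_squares_def by blast
  show ?thesis
    unfolding sum_of_three_linear_squares_def assms(2) g lin by (intro exI allI) (rule refl)
qed

text \<open>Gauss reduction: alternately reduce the binary form \<open>a f - (a x + t y + s z)\<^sup>2\<close> in \<open>y, z\<close>
  and exchange \<open>x\<close> with \<open>y\<close>, which decreases \<open>a\<close> until \<open>a\<^sup>3 \<le> 64/27\<close>.\<close>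
lemma unimodular_ternary_form:
  fixes a b c r s t :: int
  assumes "a > 0" "a * b - t\<^sup>2 > 0" "a * b * c + 2 * r * s * t - a * r\<^sup>2 - b * s\<^sup>2 - c * t\<^sup>2 = 1"
  shows "sum_of_three_linear_squares (ternary_form a b c r s t)"
  using assms
proof (induction "nat a" arbitrary: a b c r s t rule: less_induct)
  case less
  \<comment> \<open>The associated binary form has determinant a times that of the ternary form,
    hence a.\<close>
  have disc: "(a * b - t\<^sup>2) * (a * c - s\<^sup>2) - (a * r - s * t)\<^sup>2 = a"
  proof -
    have "(a * b - t\<^sup>2) * (a * c - s\<^sup>2) - (a * r - s * t)\<^sup>2
        = a * (a * b * c + 2 * r * s * t - a * r\<^sup>2 - b * s\<^sup>2 - c * t\<^sup>2)"
      by (simp add: power2_eq_square algebra_simps)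
    then show ?thesis using less.prems(3) by simp
  qed
  obtain p q g h where pqgh: "p * h - q * g = 1"
    and pos: "(a * b - t\<^sup>2) * p\<^sup>2 + 2 * (a * r - s * t) * p * g + (a * c - s\<^sup>2) * g\<^sup>2 > 0"
    and le: "3 * ((a * b - t\<^sup>2) * p\<^sup>2 + 2 * (a * r - s * t) * p * g + (a * c - s\<^sup>2) * g\<^sup>2)\<^sup>2 \<le> 4 * a"
    using binary_form_reduction[of "a * b - t\<^sup>2" "a * c - s\<^sup>2" "a * r - s * t"] disc less.prems(1,2)
    by (metis (no_types, lifting))
  define b1 where "b1 = b * p\<^sup>2 + 2 * r * p * g + c * g\<^sup>2"
  define c1 where "c1 = b * q\<^sup>2 + 2 * r * q * h + c * h\<^sup>2"
  define r1 where "r1 = b * p * q + r * (p * h + q * g) + c * g * h"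
  define s1 where "s1 = t * q + s * h"
  define t1 where "t1 = t * p + s * g"
  \<comment> \<open>Shifting x by a multiple of y makes \<bar>2 * t2\<bar> \<le> a without changing
    the minor a * b1 - t1^2.\<close>
  define k where "k = - ((2 * t1 + a) div (2 * a))"
  define t2 where "t2 = t1 + k * a"
  define b2 where "b2 = b1 + 2 * k * t1 + k\<^sup>2 * a"
  define r2 where "r2 = r1 + k * s1"
  define A where "A = a * b2 - t2\<^sup>2"
  have A_eq: "A = (a * b - t\<^sup>2) * p\<^sup>2 + 2 * (a * r - s * t) * p * g + (a * c - s\<^sup>2) * g\<^sup>2"
    by (simp add: A_def b2_def t2_def b1_def t1_def power2_eq_square algebra_simps)
  have "A > 0" "3 * A\<^sup>2 \<le> 4 * a" using pos le by (simp_all add: A_eq)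
  have det: "a * b2 * c1 + 2 * r2 * s1 * t2 - a * r2\<^sup>2 - b2 * s1\<^sup>2 - c1 * t2\<^sup>2 = 1"
  proof -
    have "a * b2 * c1 + 2 * r2 * s1 * t2 - a * r2\<^sup>2 - b2 * s1\<^sup>2 - c1 * t2\<^sup>2
        = a * b1 * c1 + 2 * r1 * s1 * t1 - a * r1\<^sup>2 - b1 * s1\<^sup>2 - c1 * t1\<^sup>2"
      by (simp add: b2_def r2_def t2_def power2_eq_square algebra_simps)
    also have "\<dots> = (a * b * c + 2 * r * s * t - a * r\<^sup>2 - b * s\<^sup>2 - c * t\<^sup>2) * (p * h - q * g)\<^sup>2"
      by (simp add: b1_def c1_def r1_def s1_def t1_def power2_eq_square algebra_simps)
    finally show ?thesis using pqgh less.prems(3) by simp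
  qed
  have "(2 * t1 + a) mod (2 * a) = 2 * t2 + a"
    by (simp add: t2_def k_def minus_div_mult_eq_mod[symmetric] algebra_simps)
  then have "0 \<le> 2 * t2 + a" "2 * t2 + a < 2 * a"
    using less.prems(1) pos_mod_bound[of "2 * a" "2 * t1 + a"] pos_mod_sign[of "2 * a" "2 * t1 + a"] by auto
  then have abst: "\<bar>2 * t2\<bar> \<le> a" by linarith
  have "a * b2 > 0" using \<open>A > 0\<close> zero_le_power2[of t2] unfolding A_def by linarith
  then have "b2 > 0" using less.prems(1) by (simp add: zero_less_mult_iff)
  have new: "sum_of_three_linear_squares (ternary_form a b2 c1 r2 s1 t2)"
  proof (cases "b2 < a")
    case True
    have "sum_of_three_linear_squares (ternary_form b2 a c1 s1 r2 t2)"
      using True \<open>b2 > 0\<close> \<open>A > 0\<close> det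
      by (intro less.hyps) (auto simp: A_def algebra_simps)
    then show ?thesis
      by (rule sum_of_three_linear_squares_subst[where ?a1.0 = 0 and ?b1.0 = 1 and ?c1.0 = 0
            and ?a2.0 = 1 and ?b2.0 = 0 and ?c2.0 = 0 and ?a3.0 = 0 and ?b3.0 = 0 and ?c3.0 = 1])
         (simp add: ternary_form_def algebra_simps)
  next
    case False
    have "(2 * t2)\<^sup>2 \<le> a\<^sup>2" using power_mono[OF abst, of 2] by simp
    moreover have "a * a \<le> a * b2" using False less.prems(1) by (intro mult_left_mono) auto
    ultimately have "3 * a\<^sup>2 \<le> 4 * A" unfolding A_def by (simp add: power2_eq_square)
    \<comment> \<open>The bounds 3 * a^2 \<le> 4 * A and 3 * A^2 \<le> 4 * a limit each other;
      eliminating A gives 27 * a^3 \<le> 64, so a = 1 and then A = 1.\<close>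
    then have "(3 * a\<^sup>2)\<^sup>2 \<le> (4 * A)\<^sup>2" by (intro power_mono) auto
    then have "9 * a ^ 4 \<le> 16 * A\<^sup>2" by (simp add: power_mult_distrib)
    then have "27 * a ^ 4 \<le> 64 * a" using \<open>3 * A\<^sup>2 \<le> 4 * a\<close> by linarith
    then have "a * (27 * a ^ 3) \<le> a * 64" by (simp add: power_Suc[symmetric] eval_nat_numeral)
    then have "27 * a ^ 3 \<le> 64" using less.prems(1) by simp
    moreover have "2 ^ 3 \<le> a ^ 3" if "a \<ge> 2" using that by (intro power_mono) auto
    ultimately have "a = 1" using less.prems(1) by fastforce
    then have "t2 = 0" using abst by auto
    have "A = 1"
    proof -
      have "2\<^sup>2 \<le> A\<^sup>2" if "A \<ge> 2" using that by (intro power_mono) auto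
      then show ?thesis using \<open>A > 0\<close> \<open>3 * A\<^sup>2 \<le> 4 * a\<close> \<open>a = 1\<close> by fastforce
    qed
    then have "b2 = 1" using \<open>a = 1\<close> \<open>t2 = 0\<close> by (simp add: A_def)
    then have "c1 = 1 + r2\<^sup>2 + s1\<^sup>2" using det \<open>a = 1\<close> \<open>t2 = 0\<close> by simp
    then have "ternary_form a b2 c1 r2 s1 t2 x y z = (1 * x + 0 * y + s1 * z)\<^sup>2 + (0 * x + 1 * y + r2 * z)\<^sup>2 + (0 * x + 0 * y + 1 * z)\<^sup>2"
      for x y z
      by (simp add: ternary_form_def \<open>a = 1\<close> \<open>b2 = 1\<close> \<open>t2 = 0\<close> power2_eq_square algebra_simps)
    then show ?thesis unfolding sum_of_three_linear_squares_def by blast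
  qed
  have forward: "ternary_form a b2 c1 r2 s1 t2 x y z
      = ternary_form a b c r s t (x + k * y) (p * y + q * z) (g * y + h * z)" for x y z
    by (simp add: ternary_form_def b2_def r2_def t2_def b1_def c1_def r1_def s1_def t1_def
        power2_eq_square algebra_simps)
  show ?case
  proof (rule sum_of_three_linear_squares_subst[OF new])
    fix x y z
    have "p * (h * y - q * z) + q * (- g * y + p * z) = (p * h - q * g) * y"
      "g * (h * y - q * z) + h * (- g * y + p * z) = (p * h - q * g) * z"
      by (simp_all add: algebra_simps)
    then have "ternary_form a b c r s t x y z
        = ternary_form a b2 c1 r2 s1 t2 (x - k * (h * y - q * z)) (h * y - q * z) (- g * y + p * z)"
      unfolding forward using pqgh by simp
    then show "ternary_form a b c r s t x y z = ternary_form a b2 c1 r2 s1 t2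
        (1 * x + (- k * h) * y + (k * q) * z) (0 * x + h * y + (- q) * z) (0 * x + (- g) * y + p * z)"
      by (simp add: algebra_simps)
  qed
qed

section \<open>The three squares theorem\<close>

text \<open>The two quotients complete m, b, e to a ternary form with leading minor D and
  determinant D * f - m * e^2 = 1; its value m at (1, 0, 0) becomes a sum of three squares. A common
  divisor of the three roots divides m and b, hence D = m * c - b^2, hence the determinant
  1.\<close>

lemma primitive_three_squares_of_congruences:
  fixes m D e b :: int
  assumes "m > 0" "D > 0" "D dvd m * e\<^sup>2 + 1" "m dvd b\<^sup>2 + D"
  shows "\<exists>x y z. x\<^sup>2 + y\<^sup>2 + z\<^sup>2 = m \<and> gcd x (gcd y z) = 1"
proof -
  obtain f where f: "m * e\<^sup>2 + 1 = D * f" using assms(3) by blast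
  obtain c where c: "b\<^sup>2 + D = m * c" using assms(4) by blast
  have D: "m * c - b\<^sup>2 = D" using c by simp
  have "m * c * f + 2 * e * 0 * b - m * e\<^sup>2 - c * 0\<^sup>2 - f * b\<^sup>2 = (m * c - b\<^sup>2) * f - m * e\<^sup>2"
    by (simp add: algebra_simps)
  also have "\<dots> = 1" unfolding D using f by simp
  finally have "sum_of_three_linear_squares (ternary_form m c f e 0 b)"
    using assms(1,2) D by (intro unimodular_ternary_form) auto
  then obtain u1 v1 w1 u2 v2 w2 u3 v3 w3 where uvw: "\<And>x y z. ternary_form m c f e 0 b x y z
      = (u1 * x + v1 * y + w1 * z)\<^sup>2 + (u2 * x + v2 * y + w2 * z)\<^sup>2 + (u3 * x + v3 * y + w3 * z)\<^sup>2"
    unfolding sum_of_three_linear_squares_def by blast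
  have u: "u1\<^sup>2 + u2\<^sup>2 + u3\<^sup>2 = m" and v: "v1\<^sup>2 + v2\<^sup>2 + v3\<^sup>2 = c"
    using uvw[of 1 0 0] uvw[of 0 1 0] by (simp_all add: ternary_form_def)
  \<comment> \<open>Polarisation: b is the inner product of the first two coefficient
    vectors.\<close>
  have "m + c + 2 * b = (u1 + v1)\<^sup>2 + (u2 + v2)\<^sup>2 + (u3 + v3)\<^sup>2"
    using uvw[of 1 1 0] by (simp add: ternary_form_def)
  also have "\<dots> = m + c + 2 * (u1 * v1 + u2 * v2 + u3 * v3)"
    unfolding u[symmetric] v[symmetric] by (simp add: power2_eq_square algebra_simps)
  finally have b: "b = u1 * v1 + u2 * v2 + u3 * v3" by simp
  define d where "d = gcd u1 (gcd u2 u3)"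
  have d: "d dvd u1" "d dvd u2" "d dvd u3" unfolding d_def by (meson gcd_dvd1 gcd_dvd2 dvd_trans)+
  have "d dvd m" "d dvd b"
    unfolding u[symmetric] b power2_eq_square by (intro dvd_add dvd_mult2 d)+
  then have "d dvd D" unfolding D[symmetric] by (simp add: power2_eq_square)
  then have "d dvd D * f - m * e\<^sup>2" using \<open>d dvd m\<close> by simp
  then have "d dvd 1" using f by (metis add_diff_cancel_left')
  then have "d = 1" by (simp add: d_def)
  with u have "u1\<^sup>2 + u2\<^sup>2 + u3\<^sup>2 = m \<and> gcd u1 (gcd u2 u3) = 1" by (simp add: d_def)
  then show ?thesis by (intro exI)
qed

lemma ex_inverse_square_root:
  assumes "prime p" "Legendre (- m) (int p) = 1"
  shows "\<exists>e. int p dvd m * e\<^sup>2 + 1"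
proof -
  obtain y where y: "[y\<^sup>2 = - m] (mod int p)" and "\<not> int p dvd m"
    using assms(2) by (auto simp: Legendre_def QuadRes_def cong_0_iff split: if_splits)
  have "\<not> int p dvd y"
  proof
    assume "int p dvd y"
    then have "int p dvd y\<^sup>2" by (simp add: power2_eq_square)
    moreover have "int p dvd y\<^sup>2 + m" using y by (simp add: cong_iff_dvd_diff)
    ultimately show False using \<open>\<not> int p dvd m\<close> by (simp add: dvd_add_right_iff)
  qed
  then have "coprime (int p) y" using assms(1) by (intro prime_imp_coprime) auto
  then obtain x where x: "[y * x = 1] (mod int p)"
    using cong_solve_coprime_int coprime_commute by blast
  have "[y\<^sup>2 * x\<^sup>2 = - m * x\<^sup>2] (mod int p)" using y by (rule cong_scalar_right)
  moreover have "[y\<^sup>2 * x\<^sup>2 = 1] (mod int p)" using cong_pow[OF x, of 2] by (simp add: power_mult_distrib)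
  ultimately have "[1 = - m * x\<^sup>2] (mod int p)" using cong_sym cong_trans by blast
  then show ?thesis by (auto simp: cong_iff_dvd_diff add.commute)
qed

text \<open>Since p is 1 modulo 4, reciprocity has no sign, so prescribing (p/q) = \<phi> q at the
  primes q dividing k also fixes (q/p), and multiplicativity yields (k/p).\<close>

lemma ex_prime_matching_character:
  assumes "odd k" "real_character \<phi>" and nz: "\<And>n. odd n \<Longrightarrow> \<phi> n \<noteq> 0" and "r \<in> {1, 5}"
  obtains p where "prime p" "p mod 8 = r" "\<And>q. prime q \<Longrightarrow> q dvd k \<Longrightarrow> legendre_char q p = \<phi> q"
    "legendre_char p k = \<phi> k"
proof -
  have "k > 0" using assms(1) by (auto intro: Nat.gr0I)
  define S where "S = {q. prime q \<and> q dvd k}"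
  have q2: "q > 2" "odd q" if "q \<in> S" for q
  proof -
    show "odd q" using that assms(1) by (auto simp: S_def intro: dvd_trans)
    then show "q > 2" using that prime_ge_2_nat[of q] by (cases "q = 2") (auto simp: S_def)
  qed
  have "finite S" using \<open>k > 0\<close> by (simp add: S_def)
  moreover have "\<phi> q \<in> {-1, 1}" if "q \<in> S" for q
    using real_character.range[OF assms(2), of q] nz[OF q2(2)[OF that]] by auto
  ultimately obtain p where p: "prime p" "p mod 8 = r" "\<And>q. q \<in> S \<Longrightarrow> legendre_char q p = \<phi> q"
    using ex_prime_with_legendre_values[of S \<phi> r] assms(4) q2 by (metis (mono_tags) S_def mem_Collect_eq)
  have p4: "p mod 4 = 1"
    using p(2) assms(4) mod_mod_cancel[of 4 8 p] by auto
  have "p > 2" using p4 prime_ge_2_nat[OF p(1)] by (cases "p = 2") auto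
  have "legendre_char p k = \<phi> k"
  proof (rule real_character_eqI[OF real_character_legendre[OF p(1) \<open>p > 2\<close>] assms(2) \<open>k > 0\<close>])
    fix q assume q: "prime q" "q dvd k"
    then have "q \<in> S" by (simp add: S_def)
    have "p \<noteq> q"
    proof
      assume "p = q"
      then have "legendre_char q p = 0" by (simp add: legendre_char_def Legendre_def cong_0_iff)
      then show False using p(3)[OF \<open>q \<in> S\<close>] nz[OF q2(2)[OF \<open>q \<in> S\<close>]] by simp
    qed
    then have "legendre_char p q = legendre_char q p"
      using Legendre_swap[OF p(1) p4 q(1)] q2[OF \<open>q \<in> S\<close>] by (simp add: legendre_char_def)
    then show "legendre_char p q = \<phi> q" using p(3)[OF \<open>q \<in> S\<close>] by simp
  qed
  then show thesis using that p by (simp add: S_def)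
qed

lemma char4_odd: "odd n \<Longrightarrow> char4 n = (if n mod 4 = 1 then 1 else -1)"
  and char8_odd: "odd n \<Longrightarrow> char8 n = (if n mod 8 \<in> {1, 7} then 1 else -1)"
proof -
  assume "odd n"
  then have "n mod 4 \<in> {1, 3}" "n mod 8 \<in> {1, 3, 5, 7}" by auto presburger+
  then show "char4 n = (if n mod 4 = 1 then 1 else -1)" "char8 n = (if n mod 8 \<in> {1, 7} then 1 else -1)"
    by (auto simp: char4_def char8_def)
qed

lemma Legendre_minus_one_char4: "prime q \<Longrightarrow> q > 2 \<Longrightarrow> real_of_int (Legendre (-1) (int q)) = char4 q"
  using Legendre_minus_one[of q] char4_odd[of q] prime_odd_nat[of q] by auto

lemma Legendre_two_char8: "prime q \<Longrightarrow> q > 2 \<Longrightarrow> real_of_int (Legendre 2 (int q)) = char8 q"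
  using Legendre_two[of q] char8_odd[of q] prime_odd_nat[of q] by auto

lemma odd_prime_divisor_gt_2: "odd (k :: nat) \<Longrightarrow> prime q \<Longrightarrow> q dvd k \<Longrightarrow> q > 2"
  using prime_ge_2_nat[of q] by (cases "q = 2") auto

text \<open>Take D = p if m is 1 or 2 modulo 4, and D = 2 * p if m is 3 modulo 8. The prescribed
  character is (-1/q), respectively (-2/q), so that -D is a square modulo every odd prime factor q
  of m; it remains to get (-m/p) = 1. For m congruent to 3 modulo 8, the choice D = p would give
  (-m/p) = \<open>char4\<close> m = -1, and the extra factor \<open>char8\<close> m = -1 repairs the
  sign.\<close>

theorem primitive_three_squares:
  fixes m :: nat
  assumes "m mod 4 \<in> {1, 2} \<or> m mod 8 = 3"
  shows "\<exists>x y z :: int. x\<^sup>2 + y\<^sup>2 + z\<^sup>2 = int m \<and> gcd x (gcd y z) = 1"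
proof -
  have sq: "char4 n * char4 n = 1" "char8 n * char8 n = 1" if "odd n" for n
    using char4_odd[OF that] char8_odd[OF that] by auto
  have nz: "char4 n \<noteq> 0" "char8 n \<noteq> 0" if "odd n" for n
    using char4_odd[OF that] char8_odd[OF that] by auto
  have "m > 0" using assms by (auto intro: Nat.gr0I)
  consider "m mod 4 = 1" | "m mod 4 = 2" | "m mod 8 = 3" using assms by auto
  then have "\<exists>D e b. D > 0 \<and> D dvd int m * e\<^sup>2 + 1 \<and> int m dvd b\<^sup>2 + D"
  proof cases
    case 1
    then have "odd m" by presburger
    obtain p where p: "prime p" "p mod 8 = 1" "\<And>q. prime q \<Longrightarrow> q dvd m \<Longrightarrow> legendre_char q p = char4 q"
      "legendre_char p m = char4 m"
      using ex_prime_matching_character[OF \<open>odd m\<close> real_character_char4, of 1] nz by auto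
    have "p > 2" using p(2) prime_ge_2_nat[OF p(1)] by (cases "p = 2") auto
    have "odd p" "p mod 4 = 1" using p(2) by presburger+
    have "real_of_int (Legendre (- int m) (int p)) = char4 p * char4 m"
      using Legendre_mult[OF p(1) \<open>p > 2\<close>, of "-1" "int m"] p(4)
        Legendre_minus_one_char4[OF p(1) \<open>p > 2\<close>] by (simp add: legendre_char_def)
    then have "Legendre (- int m) (int p) = 1"
      using 1 \<open>p mod 4 = 1\<close> by (simp add: char4_def)
    then obtain e where "int p dvd int m * e\<^sup>2 + 1"
      using ex_inverse_square_root p(1) by blast
    moreover have "Legendre (- int p) (int q) = 1" if "prime q" "q dvd m" for q
    proof -
      note q2 = odd_prime_divisor_gt_2[OF \<open>odd m\<close> that]
      have "real_of_int (Legendre (- int p) (int q)) = char4 q * char4 q"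
        using Legendre_mult[OF that(1) q2, of "-1" "int p"] p(3)[OF that]
          Legendre_minus_one_char4[OF that(1) q2] by (simp add: legendre_char_def)
      then show ?thesis using sq(1)[of q] q2 prime_odd_nat[OF that(1)] by simp
    qed
    then obtain b where "int m dvd b\<^sup>2 - (- int p)"
      using square_root_mod_lift[OF \<open>m > 0\<close> \<open>odd m\<close>] by blast
    ultimately have "int p > 0 \<and> int p dvd int m * e\<^sup>2 + 1 \<and> int m dvd b\<^sup>2 + int p"
      using \<open>p > 2\<close> by simp
    then show ?thesis by (intro exI)
  next
    case 2
    define k where "k = m div 2"
    have k: "m = 2 * k" "odd k" using 2 unfolding k_def by presburger+
    have "k > 0" using k(2) by (auto intro: Nat.gr0I)
    \<comment> \<open>Here (-m/p) = (2/p) * \<open>char4\<close> k, and the residue 1 or 5 of p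
      gives (2/p) the sign of \<open>char4\<close> k.\<close>
    define r :: nat where "r = (if k mod 4 = 1 then 1 else 5)"
    have r: "r \<in> {1, 5}" by (simp add: r_def)
    obtain p where p: "prime p" "p mod 8 = r" "\<And>q. prime q \<Longrightarrow> q dvd k \<Longrightarrow> legendre_char q p = char4 q"
      "legendre_char p k = char4 k"
      using ex_prime_matching_character[OF \<open>odd k\<close> real_character_char4 nz(1) r] by blast
    have "p mod 4 = 1" "odd p"
      using p(2) mod_mod_cancel[of 4 8 p] mod_mod_cancel[of 2 8 p]
      by (auto simp: r_def odd_iff_mod_2_eq_one split: if_splits)
    then have "p > 2" using prime_ge_2_nat[OF p(1)] by (cases "p = 2") auto
    have "Legendre (- int m) (int p) = Legendre (-1) (int p) * (Legendre 2 (int p) * Legendre (int k) (int p))"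
      using Legendre_mult[OF p(1) \<open>p > 2\<close>, of "-1" "int m"] Legendre_mult[OF p(1) \<open>p > 2\<close>, of 2 "int k"]
      by (simp add: k(1))
    then have "real_of_int (Legendre (- int m) (int p)) = char4 p * (char8 p * char4 k)"
      using p(4) Legendre_minus_one_char4[OF p(1) \<open>p > 2\<close>] Legendre_two_char8[OF p(1) \<open>p > 2\<close>]
      by (simp add: legendre_char_def)
    then have "Legendre (- int m) (int p) = 1"
      using \<open>p mod 4 = 1\<close> p(2) char4_odd[OF k(2)] by (simp add: char4_def[of p] char8_def r_def split: if_splits)
    then obtain e where "int p dvd int m * e\<^sup>2 + 1"
      using ex_inverse_square_root p(1) by blast
    moreover have "Legendre (- int p) (int q) = 1" if "prime q" "q dvd k" for q
    proof -
      note q2 = odd_prime_divisor_gt_2[OF \<open>odd k\<close> that]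
      have "real_of_int (Legendre (- int p) (int q)) = char4 q * char4 q"
        using Legendre_mult[OF that(1) q2, of "-1" "int p"] p(3)[OF that]
          Legendre_minus_one_char4[OF that(1) q2] by (simp add: legendre_char_def)
      then show ?thesis using sq(1)[of q] q2 prime_odd_nat[OF that(1)] by simp
    qed
    then obtain b where b: "int k dvd b\<^sup>2 - (- int p)"
      using square_root_mod_lift[OF \<open>k > 0\<close> \<open>odd k\<close>] by blast
    \<comment> \<open>The modulus m = 2 * k also requires b^2 + p to be even; adding the odd k
      corrects the parity without affecting divisibility by k.\<close>
    define b' where "b' = (if odd b then b else b + int k)"
    have "int k dvd b'\<^sup>2 + int p"
    proof (cases "odd b")
      case False
      have "b'\<^sup>2 + int p = (b\<^sup>2 - (- int p)) + int k * (2 * b + int k)"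
        using False by (simp add: b'_def power2_eq_square algebra_simps)
      then show ?thesis using b by (metis dvd_add dvd_triv_left)
    qed (use b in \<open>simp add: b'_def\<close>)
    moreover have "2 dvd b'\<^sup>2 + int p"
      using \<open>odd p\<close> k(2) by (simp add: b'_def)
    moreover have "coprime 2 (int k)" using k(2) by simp
    ultimately have "int m dvd b'\<^sup>2 + int p"
      unfolding k(1) by (simp add: divides_mult)
    with \<open>int p dvd int m * e\<^sup>2 + 1\<close> \<open>p > 2\<close>
    have "int p > 0 \<and> int p dvd int m * e\<^sup>2 + 1 \<and> int m dvd b'\<^sup>2 + int p" by simp
    then show ?thesis by (intro exI)
  next
    case 3
    then have "odd m" "m mod 4 = 3" by presburger+
    obtain p where p: "prime p" "p mod 8 = 1"
      "\<And>q. prime q \<Longrightarrow> q dvd m \<Longrightarrow> legendre_char q p = char4 q * char8 q"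
      "legendre_char p m = char4 m * char8 m"
      using ex_prime_matching_character[OF \<open>odd m\<close> real_character_mult[OF real_character_char4 real_character_char8], of 1]
        nz by auto
    have "p > 2" using p(2) prime_ge_2_nat[OF p(1)] by (cases "p = 2") auto
    have "odd p" "p mod 4 = 1" using p(2) by presburger+
    have "real_of_int (Legendre (- int m) (int p)) = char4 p * (char4 m * char8 m)"
      using Legendre_mult[OF p(1) \<open>p > 2\<close>, of "-1" "int m"] p(4)
        Legendre_minus_one_char4[OF p(1) \<open>p > 2\<close>] by (simp add: legendre_char_def)
    then have "Legendre (- int m) (int p) = 1"
      using 3 \<open>m mod 4 = 3\<close> \<open>p mod 4 = 1\<close> by (simp add: char4_def char8_def)
    then obtain e where e: "int p dvd int m * e\<^sup>2 + 1"
      using ex_inverse_square_root p(1) by blast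
    \<comment> \<open>The factor 2 of D requires m * e^2 + 1 to be even, so e must be odd; adding
      the odd p achieves this.\<close>
    define e' where "e' = (if odd e then e else e + int p)"
    have "int p dvd int m * e'\<^sup>2 + 1"
    proof (cases "odd e")
      case False
      have "int m * e'\<^sup>2 + 1 = (int m * e\<^sup>2 + 1) + int p * (int m * (2 * e + int p))"
        using False by (simp add: e'_def power2_eq_square algebra_simps)
      then show ?thesis using e by (metis dvd_add dvd_triv_left)
    qed (use e in \<open>simp add: e'_def\<close>)
    moreover have "2 dvd int m * e'\<^sup>2 + 1"
      using \<open>odd p\<close> \<open>odd m\<close> by (simp add: e'_def)
    moreover have "coprime 2 (int p)" using \<open>odd p\<close> by simp
    ultimately have "2 * int p dvd int m * e'\<^sup>2 + 1"
      by (simp add: divides_mult)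
    moreover have "Legendre (- (2 * int p)) (int q) = 1" if "prime q" "q dvd m" for q
    proof -
      note q2 = odd_prime_divisor_gt_2[OF \<open>odd m\<close> that]
      have "Legendre (- (2 * int p)) (int q) = Legendre (-1) (int q) * (Legendre 2 (int q) * Legendre (int p) (int q))"
        using Legendre_mult[OF that(1) q2, of "-1" "2 * int p"] Legendre_mult[OF that(1) q2, of 2 "int p"] by simp
      then have "real_of_int (Legendre (- (2 * int p)) (int q)) = (char4 q * char4 q) * (char8 q * char8 q)"
        using p(3)[OF that] Legendre_minus_one_char4[OF that(1) q2] Legendre_two_char8[OF that(1) q2]
        by (simp add: legendre_char_def)
      then show ?thesis using sq[of q] q2 prime_odd_nat[OF that(1)] by simp
    qed
    then obtain b where "int m dvd b\<^sup>2 - (- (2 * int p))"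
      using square_root_mod_lift[OF \<open>m > 0\<close> \<open>odd m\<close>] by blast
    ultimately have "2 * int p > 0 \<and> 2 * int p dvd int m * e'\<^sup>2 + 1 \<and> int m dvd b\<^sup>2 + 2 * int p"
      using \<open>p > 2\<close> by simp
    then show ?thesis by (intro exI)
  qed
  then show ?thesis
    using primitive_three_squares_of_congruences \<open>m > 0\<close> by (metis of_nat_0_less_iff)
qed

section \<open>The quaternary form\<close>

lemma sublattice_represents:
  fixes m :: nat
  assumes "m mod 4 \<in> {1, 2} \<or> m mod 8 = 3"
  shows "\<exists>x y w. Q31_2 x y 0 w = int m \<and> gcd x (gcd y w) = 1"
proof -
  have main: "\<exists>x y w. Q31_2 x y 0 w = int m \<and> gcd x (gcd y w) = 1"
    if abc: "a\<^sup>2 + b\<^sup>2 + c\<^sup>2 = int m" "gcd a (gcd b c) = 1" "3 dvd b + c" for a b c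
  proof -
    \<comment> \<open>The coordinates come from (y - w)^2 + (y + 2 * w)^2 = 2 * y^2 + 2 * y * w + 5
      * w^2, with b = y - w and c = -(y + 2 * w).\<close>
    obtain w where w: "b + c = 3 * (- w)" using abc(3) by (metis dvdE minus_minus)
    define y where "y = b + w"
    have bc: "b = y - w" "c = - y - 2 * w" using w by (simp_all add: y_def)
    have "Q31_2 a y 0 w = int m"
      using abc(1) unfolding bc Q31_2_def by (simp add: power2_eq_square algebra_simps)
    have "gcd a (gcd y w) dvd gcd a (gcd b c)"
    proof -
      have "gcd a (gcd y w) dvd y" "gcd a (gcd y w) dvd w"
        by (meson gcd_dvd2 gcd_dvd1 dvd_trans)+
      then show ?thesis
        unfolding bc by (intro gcd_greatest gcd_dvd1 dvd_diff dvd_mult) (simp_all only: dvd_minus_iff)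
    qed
    then have "gcd a (gcd y w) = 1" by (simp only: abc(2) is_unit_gcd_iff)
    with \<open>Q31_2 a y 0 w = int m\<close> have "Q31_2 a y 0 w = int m \<and> gcd a (gcd y w) = 1" ..
    then show ?thesis by (intro exI)
  qed
  obtain a b c where abc: "a\<^sup>2 + b\<^sup>2 + c\<^sup>2 = int m" "gcd a (gcd b c) = 1"
    using primitive_three_squares[OF assms] by metis
  have signed: "\<exists>x y w. Q31_2 x y 0 w = int m \<and> gcd x (gcd y w) = 1"
    if "u\<^sup>2 + v\<^sup>2 + t\<^sup>2 = int m" "gcd u (gcd v t) = 1" "3 dvd v \<longleftrightarrow> 3 dvd t" for u v t
  proof -
    have "3 dvd v + t \<or> 3 dvd v + (- t)" using that(3) by presburger
    then show ?thesis using main[of u v t] main[of u v "- t"] that(1,2) by auto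
  qed
  have "b\<^sup>2 + a\<^sup>2 + c\<^sup>2 = int m" "c\<^sup>2 + a\<^sup>2 + b\<^sup>2 = int m" using abc(1) by linarith+
  moreover have "gcd b (gcd a c) = 1" "gcd c (gcd a b) = 1"
    using abc(2) by (simp_all only: gcd.left_commute[of b a c] gcd.commute[of c "gcd a b"] gcd.assoc)
  moreover have "(3 dvd b \<longleftrightarrow> 3 dvd c) \<or> (3 dvd a \<longleftrightarrow> 3 dvd c) \<or> (3 dvd a \<longleftrightarrow> 3 dvd b)" by blast
  ultimately show ?thesis
    using signed[of a b c] signed[of b a c] signed[of c a b] abc by argo
qed

text \<open>The vector \<open>(0, 5, -9, -1)\<close> of norm \<open>279\<close> spans the orthogonal complement of the sublattice \<open>z = 0\<close>.\<close>
lemma Q31_2_orthogonal: "Q31_2 x (y + 5 * k) (- 9 * k) (w - k) = Q31_2 x y 0 w + 279 * k\<^sup>2"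
  by (simp add: Q31_2_def power2_eq_square algebra_simps)

text \<open>Only \<open>3\<close> can divide a translate of a primitive vector, and not for both signs of the vector.\<close>
lemma primitive_translate:
  fixes x y w k :: int
  assumes "gcd x (gcd y w) = 1" "k \<in> {1, 2}"
  shows "Gcd {x, y + 5 * k, - 9 * k, w - k} = 1 \<or> Gcd {- x, - y + 5 * k, - 9 * k, - w - k} = 1"
proof (rule ccontr)
  have only_3: "3 dvd c - k" if abc: "Gcd {a, b + 5 * k, - 9 * k, c - k} \<noteq> 1" "gcd a (gcd b c) = 1" for a b c
  proof -
    define g where "g = Gcd {a, b + 5 * k, - 9 * k, c - k}"
    have "g \<ge> 0" "g \<noteq> 1" unfolding g_def by (rule Gcd_int_greater_eq_0, rule abc(1))
    then obtain p where p: "prime p" "p dvd g"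
      using prime_factor_int[of g] by auto
    then have dvd: "p dvd a" "p dvd b + 5 * k" "p dvd - 9 * k" "p dvd c - k"
      by (auto simp: g_def intro: dvd_trans)
    have "p dvd 3 * 3 * k" using dvd(3) by simp
    then have "p dvd 3 \<or> p dvd k" using p(1) by (metis prime_dvd_mult_iff)
    moreover have "\<not> p dvd k"
    proof
      assume "p dvd k"
      then have "p dvd b" "p dvd c"
        using dvd(2,4) by (metis dvd_add_left_iff dvd_mult, metis dvd_diff_right_iff dvd_refl diff_add_cancel dvd_add)
      then have "p dvd 1" using dvd(1) abc(2) by (metis gcd_greatest)
      then show False using p(1) not_prime_unit by blast
    qed
    ultimately have "p dvd 3" by blast
    then have "p \<le> 3" by (rule zdvd_imp_le) simp
    moreover have "p \<noteq> 2" using \<open>p dvd 3\<close> by auto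
    ultimately have "p = 3" using prime_ge_2_int[OF p(1)] by linarith
    then show ?thesis using dvd(4) by simp
  qed
  have neg: "gcd (- x) (gcd (- y) (- w)) = 1"
    using assms(1) by (simp only: gcd_neg1_int gcd_neg2_int)
  assume "\<not> ?thesis"
  then have ne: "Gcd {x, y + 5 * k, - 9 * k, w - k} \<noteq> 1" "Gcd {- x, - y + 5 * k, - 9 * k, - w - k} \<noteq> 1"
    by blast+
  have "3 dvd w - k" "3 dvd - w - k"
    by (rule only_3[OF ne(1) assms(1)], rule only_3[OF ne(2) neg])
  \<comment> \<open>The sum is -2 * k, which is not a multiple of 3 for k = 1 or 2.\<close>
  then have "3 dvd (w - k) + (- w - k)" by (rule dvd_add)
  then show False using assms(2) by auto
qed

lemma Q31_2_translate:
  assumes "n = int m + 279 * k\<^sup>2" "k \<in> {1, 2}" "m mod 4 \<in> {1, 2} \<or> m mod 8 = 3"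
  shows "\<exists>x y z w. Q31_2 x y z w = n \<and> Gcd {x, y, z, w} = 1"
proof -
  obtain x y w where xyw: "Q31_2 x y 0 w = int m" "gcd x (gcd y w) = 1"
    using sublattice_represents[OF assms(3)] by metis
  have "Q31_2 (- x) (- y) 0 (- w) = int m" using xyw(1) by (simp add: Q31_2_def)
  then have "Q31_2 x (y + 5 * k) (- 9 * k) (w - k) = n" "Q31_2 (- x) (- y + 5 * k) (- 9 * k) (- w - k) = n"
    unfolding Q31_2_orthogonal using xyw(1) assms(1) by simp_all
  then show ?thesis using primitive_translate[OF xyw(2) assms(2)] by blast
qed

section \<open>The finitely many remaining numbers\<close>

text \<open>Triples (x, z, w), to be completed by y = 1, which makes the vector primitive whatever
  the other coordinates are.\<close>

definition witnesses_7_mod_8 :: "(int \<times> int \<times> int) list" where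
  "witnesses_7_mod_8 = [
    (0, -1, -1), (0, 1, 1), (1, 2, 0), (3, 2, 0), (0, -3, 1), (1, 2, 2), (2, 3, 1), (2, 1, 3),
    (5, 2, 2), (8, 1, 1), (6, 3, 1), (0, 3, 3), (1, -2, 4), (1, 2, 4), (0, 5, 1), (2, 1, -5),
    (1, -6, 0), (0, 1, 5), (0, 5, -3), (1, 6, 0), (3, 6, 0), (1, 6, -2), (1, 6, 2), (0, -7, 1),
    (3, 2, -6), (1, -2, 6), (1, 2, 6), (2, 7, 1), (1, 6, -4), (0, 1, -7), (0, 5, 5), (3, 6, 4),
    (0, 7, 3), (2, 1, 7), (4, 7, 3), (12, 1, 5), (2, -3, 7), (0, 3, 7), (0, -9, -1), (4, 3, 7),
    (1, 2, -8), (3, 2, -8), (0, 5, -7), (0, 9, 1), (1, 2, 8), (3, 2, 8), (2, 5, 7), (1, -10, 0),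
    (0, -1, -9), (2, 9, 3), (1, -10, 2), (3, -10, 2), (1, 10, 0), (0, 1, 9), (1, 10, -2),
    (1, 10, 2), (0, -3, 9), (1, 6, -8), (0, 7, 7), (0, 9, 5), (4, 7, 7), (1, 6, 8), (1, 2, -10),
    (0, 11, -1), (2, 11, 1), (4, 11, -1), (0, 5, 9), (1, 2, 10), (3, 2, 10), (0, 11, 3), (5, 2, 10),
    (4, 11, 3), (3, -10, 6), (0, 1, -11), (0, -11, 5), (2, 9, 7), (1, 10, 6), (0, 11, -5),
    (0, -1, 11), (2, 1, 11), (2, 11, 5), (0, -13, -1), (2, -13, 1), (0, 3, 11), (1, 6, 10),
    (4, 3, 11), (0, 5, -11), (0, -13, 3), (0, 13, 1), (1, 2, -12), (4, 13, 1), (8, 3, 11),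
    (2, 5, 11), (5, 10, -8), (1, -14, 0), (1, 2, 12), (3, 2, 12), (1, -14, 2), (5, 2, 12),
    (2, 7, -11), (5, -14, 2), (1, 14, 0), (3, 14, 0), (2, 1, -13), (1, 14, 2), (3, 14, 2),
    (1, 6, -12), (0, 3, -13), (5, -14, 4), (0, 1, 13), (1, 14, -4), (4, 1, 13), (0, -3, 13),
    (3, 6, 12), (2, 3, 13), (0, 9, -11), (0, 15, -1), (2, 15, 1), (6, 3, 13), (3, -14, 6),
    (2, 13, 7), (1, 2, -14), (0, 5, 13), (3, 14, -6), (4, 5, 13), (1, 14, 6), (3, 14, 6),
    (1, -2, 14), (1, 2, 14), (3, 2, 14), (0, 15, -5), (5, 2, 14), (4, 15, -5), (2, 15, 5),
    (7, 2, 14), (2, 7, 13), (1, -14, 8), (0, 1, -15), (1, 6, -14)]"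

definition witnesses_0_mod_4 :: "(int \<times> int \<times> int) list" where
  "witnesses_0_mod_4 = [
    (0, -1, 0), (0, 1, 0), (2, 1, 0), (1, 1, 1), (3, -1, 1), (3, 1, 1), (0, -1, 2), (0, 1, 2),
    (2, 1, 2), (5, 1, 1), (0, 3, 0), (2, 3, 0), (1, 3, 1), (0, -3, 2), (1, 1, 3), (7, 1, 1),
    (0, 3, 2), (2, 3, 2), (5, 3, 1), (0, 1, -4), (4, 3, 2), (7, -3, 1), (0, -5, 0), (0, 1, 4),
    (2, 1, 4), (3, 3, 3), (7, 1, 3), (0, 5, 0), (2, 5, 0), (1, 5, 1), (1, 1, -5), (3, 5, 1),
    (0, 3, 4), (0, 5, 2), (2, 5, 2), (1, 1, 5), (4, 3, 4), (3, 1, 5), (6, -3, 4), (1, 3, -5),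
    (1, 5, 3), (5, 1, 5), (3, 5, 3), (0, 1, -6), (1, 3, 5), (0, -7, 0), (3, 3, 5), (1, -7, 1),
    (0, -1, 6), (0, 1, 6), (2, 1, 6), (0, -7, 2), (0, 7, 0), (2, 7, 0), (1, 7, 1), (0, -3, 6),
    (3, 7, 1), (2, 7, -2), (0, 3, 6), (2, 3, 6), (5, 7, 1), (1, 5, 5), (4, 3, 6), (3, 5, 5),
    (3, 7, -3), (1, 7, 3), (1, 1, 7), (3, 7, 3), (3, 1, 7)]"

text \<open>The lists end at 8 * 138 + 7 = 1111 and 4 * 68 + 4 = 276, the last members of their
  classes not exceeding 1116 = 4 * 279 and 279.\<close>

lemma witnesses:
  "map (\<lambda>(x, z, w). Q31_2 x 1 z w) witnesses_7_mod_8 = map (\<lambda>i. 8 * int i + 7) [0..<139]"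
  "map (\<lambda>(x, z, w). Q31_2 x 1 z w) witnesses_0_mod_4 = map (\<lambda>i. 4 * int i + 4) [0..<69]"
  by code_simp+

lemma Q31_2_small:
  assumes "map (\<lambda>(x, z, w). Q31_2 x 1 z w) xs = map (\<lambda>i. a * int i + b) [0..<N]" "i < N"
  shows "\<exists>x y z w. Q31_2 x y z w = a * int i + b \<and> Gcd {x, y, z, w} = 1"
proof -
  obtain x z w where "xs ! i = (x, z, w)" by (metis prod_cases3)
  moreover have "length xs = N" using arg_cong[OF assms(1), of length] by simp
  ultimately have "Q31_2 x 1 z w = a * int i + b"
    using arg_cong[OF assms(1), of "\<lambda>l. l ! i"] assms(2) by simp
  then show ?thesis by (intro exI[of _ x] exI[of _ 1] exI[of _ z] exI[of _ w]) simp
qed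

theorem theorem4p9: "primitively_universal Q31_2"
  unfolding primitively_universal_def
proof (intro allI impI)
  fix n :: int assume "n > 0"
  let ?goal = "\<exists>x y z w. Q31_2 x y z w = n \<and> Gcd {x, y, z, w} = 1"
  define m where "m = nat n"
  have n: "n = int m" "m > 0" using \<open>n > 0\<close> by (simp_all add: m_def)
  consider "m mod 4 \<in> {1, 2} \<or> m mod 8 = 3" | "m mod 4 = 0" | "m mod 8 = 7"
  proof -
    have "(m mod 4 = 1 \<or> m mod 4 = 2 \<or> m mod 8 = 3) \<or> m mod 4 = 0 \<or> m mod 8 = 7" by presburger
    then show thesis using that by auto
  qed
  then show ?goal
  proof cases
    case 1
    then obtain x y w where "Q31_2 x y 0 w = int m" "gcd x (gcd y w) = 1"
      using sublattice_represents by metis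
    then have "Q31_2 x y 0 w = n \<and> Gcd {x, y, 0, w} = 1" by (simp add: n)
    then show ?thesis by (intro exI)
  next
    case 2
    show ?thesis
    proof (cases "m > 279")
      case True
      then obtain l where l: "m = l + 279" by (metis add.commute less_imp_le le_Suc_ex)
      have "l mod 4 = 1" using 2 unfolding l by presburger
      then show ?thesis using Q31_2_translate[of n l 1] by (simp add: n(1) l)
    next
      case False
      define i where "i = m div 4 - 1"
      have "m = 4 * (m div 4)" using 2 mult_div_mod_eq[of 4 m] by simp
      then have "m = 4 * i + 4" "i < 69" using False \<open>m > 0\<close> unfolding i_def by linarith+
      then show ?thesis using Q31_2_small[OF witnesses(2), of i] by (simp add: n)
    qed
  next
    case 3
    show ?thesis
    proof (cases "m > 1116")
      case True
      \<comment> \<open>Subtracting 279 would leave a multiple of 8, so the doubled vector is used: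
        1116 is 4 modulo 8 and leaves 3.\<close>
      then obtain l where l: "m = l + 1116" by (metis add.commute less_imp_le le_Suc_ex)
      have "l mod 8 = 3" using 3 unfolding l by presburger
      then show ?thesis using Q31_2_translate[of n l 2] by (simp add: n(1) l)
    next
      case False
      define i where "i = m div 8"
      have "m = 8 * i + 7" using 3 mult_div_mod_eq[of 8 m] by (simp add: i_def)
      then have "m = 8 * i + 7" "i < 139" using False by linarith+
      then show ?thesis using Q31_2_small[OF witnesses(1), of i] by (simp add: n)
    qed
  qed
qed

end
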